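(* Let $h>0$ and $k_t>k_\ell>0$ be fixed real numbers. For $k\in\mathbb{C}$ let $p,q\in\mathbb{C}$ satisfy $p^2=k_\ell^2-k^2$ and $q^2=k_t^2-k^2$. (Symmetric case.) The solutions $k\in\mathbb{C}$ of the symmetric Rayleigh-Lamb equation $$(q^2-k^2)^2\tan(qh)=-4k^2pq\tan(ph)$$ satisfying $\Re(k)\ge 0$ and $\Im(k)\ge 0$ can, up to finitely many of them, be enumerated as a sequence $(k_n)_{n\ge n_0}$ (for some integer $n_0\geq 1$) such that, as $n\to\infty$, $$k_n=\frac{1}{2h}\ln(4\pi n)-\frac{1}{8hn}+\frac{i}{2h}\left(\pi\left(2n-\frac12\right)-\frac{\ln(4\pi n)}{2\pi n}-\frac{h^2(k_\ell^2+k_t^2)}{2\pi n}\right)+o\!\left(\frac1n\right).$$ (Antisymmetric case.) The solutions $k\in\mathbb{C}$ of the antisymmetric Rayleigh-Lamb equation $$(q^2-k^2)^2\tan(ph)=-4k^2pq\tan(qh)$$ satisfying $\Re(k)\ge 0$ and $\Im(k)\ge 0$ can, up to finitely many of them, be enumerated as a sequence $(k_n)_{n\ge n_0}$ (for some integer $n_0\geq 1$) such that, as $n\to\infty$, $$k_n=\frac{1}{2h}\ln(4\pi n)-\frac{3}{8hn}+\frac{i}{2h}\left(\pi\left(2n-\frac32\right)-\frac{\ln(4\pi n)}{2\pi n}-\frac{h^2(k_\ell^2+k_t^2)}{2\pi n}\right)+o\!\left(\frac1n\right).$$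
   Context: Physical origin: $k_t=\omega\sqrt{\rho/\mu}$ and $k_\ell=\omega\sqrt{\rho/(\lambda+2\mu)}$ are the transverse and longitudinal wavenumbers at frequency $\omega$ of an isotropic elastic plate of height $2h$, density $\rho$ and Lamé parameters $(\lambda,\mu)$ with free (Neumann) boundaries; only $h>0$ and $k_t>k_\ell>0$ matter here. Convention: the equations are understood in their pole-free form, i.e. $k$ is a solution of the symmetric equation iff $$(q^2-k^2)^2\sin(qh)\cos(ph)+4k^2pq\sin(ph)\cos(qh)=0,$$ and of the antisymmetric equation iff $$(q^2-k^2)^2\sin(ph)\cos(qh)+4k^2pq\sin(qh)\cos(ph)=0.$$ Whether $k$ is a solution does not depend on the choice of the signs of the square roots $p$ and $q$. Concretely one may take $q=ik(1-k_t^2/k^2)^{1/2}$ and $p=ik(1-k_\ell^2/k^2)^{1/2}$ for $k\neq0$ (principal square root), and $q=k_t$, $p=k_\ell$ for $k=0$. *)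

theory Defs
  imports "HOL-Analysis.Analysis" "HOL-Library.Landau_Symbols"
begin

(* The Rayleigh-Lamb equations are defined in pole-free form, i.e. after multiplying
     (q^2 - k^2)^2 tan (q h) = - 4 k^2 p q tan (p h)     (symmetric),
     (q^2 - k^2)^2 tan (p h) = - 4 k^2 p q tan (q h)     (antisymmetric)
   by cos (p h) cos (q h). This matters because HOL's tan is 0 at its poles. *)

definition rayleigh_lamb_sym :: "real \<Rightarrow> complex \<Rightarrow> complex \<Rightarrow> complex \<Rightarrow> bool" where
  "rayleigh_lamb_sym h p q k \<longleftrightarrow>
     (q\<^sup>2 - k\<^sup>2)\<^sup>2 * sin (q * of_real h) * cos (p * of_real h)
       + 4 * k\<^sup>2 * p * q * sin (p * of_real h) * cos (q * of_real h) = 0"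

definition rayleigh_lamb_antisym :: "real \<Rightarrow> complex \<Rightarrow> complex \<Rightarrow> complex \<Rightarrow> bool" where
  "rayleigh_lamb_antisym h p q k \<longleftrightarrow>
     (q\<^sup>2 - k\<^sup>2)\<^sup>2 * sin (p * of_real h) * cos (q * of_real h)
       + 4 * k\<^sup>2 * p * q * sin (q * of_real h) * cos (p * of_real h) = 0"

lemma rayleigh_lamb_sym_iff_tan:
  assumes "cos (p * of_real h) \<noteq> 0" "cos (q * of_real h) \<noteq> 0"
  shows "rayleigh_lamb_sym h p q k \<longleftrightarrow>
    (q\<^sup>2 - k\<^sup>2)\<^sup>2 * tan (q * of_real h) = - 4 * k\<^sup>2 * p * q * tan (p * of_real h)"
  using assms unfolding rayleigh_lamb_sym_def tan_def
  by (simp add: divide_simps) (simp add: eq_neg_iff_add_eq_0 mult_ac)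

lemma rayleigh_lamb_antisym_iff_tan:
  assumes "cos (p * of_real h) \<noteq> 0" "cos (q * of_real h) \<noteq> 0"
  shows "rayleigh_lamb_antisym h p q k \<longleftrightarrow>
    (q\<^sup>2 - k\<^sup>2)\<^sup>2 * tan (p * of_real h) = - 4 * k\<^sup>2 * p * q * tan (q * of_real h)"
  using assms unfolding rayleigh_lamb_antisym_def tan_def
  by (simp add: divide_simps) (simp add: eq_neg_iff_add_eq_0 mult_ac)

lemma rayleigh_lamb_sign_indep:
  assumes "p'\<^sup>2 = p\<^sup>2" "q'\<^sup>2 = q\<^sup>2"
  shows "rayleigh_lamb_sym h p' q' k \<longleftrightarrow> rayleigh_lamb_sym h p q k"
    and "rayleigh_lamb_antisym h p' q' k \<longleftrightarrow> rayleigh_lamb_antisym h p q k"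
proof -
  have "p' = p \<or> p' = - p" "q' = q \<or> q' = - q"
    using assms by (simp_all add: power2_eq_iff)
  then show "rayleigh_lamb_sym h p' q' k \<longleftrightarrow> rayleigh_lamb_sym h p q k"
    and "rayleigh_lamb_antisym h p' q' k \<longleftrightarrow> rayleigh_lamb_antisym h p q k"
    unfolding rayleigh_lamb_sym_def rayleigh_lamb_antisym_def
    by (auto simp: neg_eq_iff_add_eq_0)
qed

(* f n0, f (n0 + 1), ... lists, without repetition, all but finitely many elements of S
   and nothing else. *)
definition enumerates_up_to_finite :: "(nat \<Rightarrow> 'a) \<Rightarrow> nat \<Rightarrow> 'a set \<Rightarrow> bool" where
  "enumerates_up_to_finite f n0 S \<longleftrightarrow>
     inj_on f {n0..} \<and> f ` {n0..} \<subseteq> S \<and> finite (S - f ` {n0..})"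

end

theory Submission
  imports Defs "HOL-Complex_Analysis.Complex_Analysis" "HOL-Real_Asymp.Real_Asymp"
begin

text \<open>
  Put \<open>w = 2 h k\<close> and write \<open>q = \<i> k a\<close>, \<open>p = \<i> k b\<close> with \<open>a\<close>, \<open>b\<close> close to \<open>1\<close> for large \<open>k\<close>. By the addition
  theorems both equations become \<open>sinh (w (a + b) / 2) = \<mp> w G (1 / w\<^sup>2)\<close>, where \<open>G\<close> is analytic
  near \<open>0\<close> and \<open>G 0 = 1\<close>. For \<open>Re w \<ge> 0\<close> only one root of this quadratic equation in \<open>exp\<close> is
  possible, so the equations read \<open>exp w = \<mp> 2 w exp (\<eta> w)\<close> with
  \<open>w \<eta> w \<longrightarrow> h\<^sup>2 (k\<^sub>\<ell>\<^sup>2 + k\<^sub>t\<^sup>2)\<close>. Taking logarithms turns this into fixed point equations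
  \<open>w = ln 2 + Ln w + \<eta> w + \<i> \<pi> (2 n - \<theta>)\<close>, with \<open>\<theta> = 1\<close> in the symmetric and \<open>\<theta> = 2\<close> in the
  antisymmetric case; the right-hand side is a contraction of the half plane \<open>Im w \<ge> B\<close>, and iterating
  it twice from \<open>2 \<pi> \<i> n\<close> yields the expansion. The solutions in a disc are finite in number because,
  up to a factor \<open>q\<close> or \<open>p\<close>, they are the zeros of an entire function of \<open>k\<close>.
\<close>

section \<open>Finiteness of the solutions in a disc\<close>

text \<open>Each term of the sine series is \<open>z\<close> times a multiple of a power of
  \<open>z\<^sup>2\<close>, so \<open>sin z / z\<close> is an everywhere convergent power series in
  \<open>z\<^sup>2\<close>. Functions of \<open>p\<close> and \<open>q\<close> that are even in both
  thereby become entire in \<open>k\<close>, whatever square roots are chosen.\<close>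

lemma sinc_entire_even:
  obtains S :: "complex \<Rightarrow> complex"
  where "S holomorphic_on UNIV" "S 0 = 1" "\<And>z. sin z = z * S (z\<^sup>2)"
proof -
  define a :: "nat \<Rightarrow> complex" where "a = (\<lambda>n. of_real (sin_coeff (2 * n + 1)))"
  define S where "S = (\<lambda>x. if x = 0 then 1 else sin (csqrt x) / csqrt x)"
  have sin_series: "(\<lambda>n. z * (a n * (z\<^sup>2) ^ n)) sums sin z" for z :: complex
  proof -
    \<comment> \<open>Summation in pairs leaves only the odd terms, because the even coefficients of
      sine are 0.\<close>
    have "(\<lambda>n. \<Sum>k = n*2..<n*2+2. of_real (sin_coeff k) * z ^ k) sums sin z"
      by (rule sums_group) (use sin_converges [of z, unfolded scaleR_conv_of_real] in auto)
    then show ?thesis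
      by (simp add: a_def sin_coeff_def ac_simps flip: power_mult)
  qed
  have "(\<lambda>n. a n * (x - 0) ^ n) sums S x" for x
  proof (cases "x = 0")
    case True
    have "(\<lambda>n. a n * 0 ^ n) sums a 0"
      by (rule powser_sums_zero)
    with True show ?thesis
      by (simp add: S_def a_def sin_coeff_def)
  next
    case False
    then show ?thesis
      using sums_divide [OF sin_series [of "csqrt x"], of "csqrt x"] by (simp add: S_def)
  qed
  then have "S holomorphic_on ball 0 r" for r
    using power_series_holomorphic by blast
  then have "S field_differentiable at x" for x
    by (rule holomorphic_on_imp_differentiable_at [of _ "ball 0 (norm x + 1)"]) auto
  then have "S holomorphic_on UNIV"
    by (simp add: holomorphic_on_def)
  moreover have "sin z = z * S (z\<^sup>2)" for z
  proof (cases "z = 0")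
    case False
    \<comment> \<open>The sign remains undetermined, which is harmless since
      \<open>sin z / z\<close> is even.\<close>
    have "csqrt (z\<^sup>2) = z \<or> csqrt (z\<^sup>2) = - z"
      using power2_eq_iff [of "csqrt (z\<^sup>2)" z] by simp
    with False show ?thesis
      by (auto simp: S_def)
  qed simp
  ultimately show thesis
    using that [of S] by (simp add: S_def)
qed

lemma cos_entire_even:
  obtains C :: "complex \<Rightarrow> complex"
  where "C holomorphic_on UNIV" "\<And>z. cos z = C (z\<^sup>2)"
proof -
  obtain S :: "complex \<Rightarrow> complex" where S: "S holomorphic_on UNIV" "\<And>z. sin z = z * S (z\<^sup>2)"
    using sinc_entire_even by metis
  \<comment> \<open>This is \<open>cos z = 1 - 2 * (sin (z / 2))\<^sup>2\<close> with the sine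
    expressed through \<open>S\<close>.\<close>
  define C where "C = (\<lambda>x. 1 - x / 2 * (S (x / 4))\<^sup>2)"
  have "(S \<circ> (\<lambda>x. x / 4)) holomorphic_on UNIV"
    by (intro holomorphic_on_compose_gen [OF _ S(1)] holomorphic_intros) auto
  then have "C holomorphic_on UNIV"
    unfolding C_def o_def by (intro holomorphic_intros) auto
  moreover have "cos z = C (z\<^sup>2)" for z
    using cos_double_sin [of "z / 2"] S(2) [of "z / 2"]
    by (simp add: C_def power_mult_distrib power_divide)
  ultimately show thesis
    using that by blast
qed

text \<open>The square roots \<open>p\<close> and \<open>q\<close> need not be continuous, so the
  identity theorem is applied to an entire cofactor \<open>G\<close> of \<open>F\<close>. The value
  at \<open>k0\<close> shows that \<open>G\<close> is not identically zero, and the zeros of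
  \<open>q\<close> add at most two points. \<open>K\<close> is a separate parameter because the
  antisymmetric equation exchanges \<open>p\<close> and \<open>q\<close> but keeps the factor
  \<open>(K - 2 * k\<^sup>2)\<^sup>2\<close>.\<close>

lemma finite_zeros_in_cball:
  fixes P Q K :: complex and h \<rho> :: real and p q :: "complex \<Rightarrow> complex"
  assumes p: "\<And>k. (p k)\<^sup>2 = P - k\<^sup>2" and q: "\<And>k. (q k)\<^sup>2 = Q - k\<^sup>2"
  defines "F \<equiv> (\<lambda>k. (K - 2 * k\<^sup>2)\<^sup>2 * sin (q k * of_real h) * cos (p k * of_real h)
                     + 4 * k\<^sup>2 * p k * q k * sin (p k * of_real h) * cos (q k * of_real h))"
  assumes nz: "F k0 \<noteq> 0"
  shows "finite {k \<in> cball 0 \<rho>. F k = 0}"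
proof -
  obtain S :: "complex \<Rightarrow> complex" where S: "S holomorphic_on UNIV" "\<And>z. sin z = z * S (z\<^sup>2)"
    using sinc_entire_even by metis
  obtain C :: "complex \<Rightarrow> complex" where C: "C holomorphic_on UNIV" "\<And>z. cos z = C (z\<^sup>2)"
    using cos_entire_even by metis
  define G where "G = (\<lambda>k. (K - 2 * k\<^sup>2)\<^sup>2 * of_real h * S ((Q - k\<^sup>2) * of_real (h\<^sup>2)) * C ((P - k\<^sup>2) * of_real (h\<^sup>2))
     + 4 * k\<^sup>2 * (P - k\<^sup>2) * of_real h * S ((P - k\<^sup>2) * of_real (h\<^sup>2)) * C ((Q - k\<^sup>2) * of_real (h\<^sup>2)))"
  \<comment> \<open>\<open>F\<close> is odd in \<open>q\<close>, so it depends on the choice of the root; \<open>F / q\<close> is even in \<open>p\<close> and \<open>q\<close>, hence entire in \<open>k\<close>.\<close>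
  have F: "F k = q k * G k" for k
    unfolding F_def G_def S(2) C(2) p [symmetric] q [symmetric]
    by (simp add: power_mult_distrib) (simp add: algebra_simps power2_eq_square)
  have comp: "(\<lambda>k. f ((A - k\<^sup>2) * of_real (h\<^sup>2))) holomorphic_on UNIV"
    if "f holomorphic_on UNIV" for f A
    using holomorphic_on_compose_gen [OF _ that, of "\<lambda>k. (A - k\<^sup>2) * of_real (h\<^sup>2)" UNIV]
    by (simp add: o_def holomorphic_intros)
  have holG: "G holomorphic_on UNIV"
    unfolding G_def by (intro holomorphic_intros comp S C)
  have "finite {k \<in> cball 0 \<rho>. G k = 0}"
  proof (cases "G constant_on UNIV")
    case True
    then have "{k \<in> cball 0 \<rho>. G k = 0} = {}"
      using nz F [of k0] by (auto simp: constant_on_def)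
    then show ?thesis
      by (metis finite.emptyI)
  next
    case False
    show ?thesis
      by (rule holomorphic_compact_finite_zeros [OF holG]) (use False in auto)
  qed
  moreover have "finite {k. q k = 0}"
  proof (rule finite_subset)
    show "{k. q k = 0} \<subseteq> {csqrt Q, - csqrt Q}"
    proof
      fix k assume "k \<in> {k. q k = 0}"
      then have "k\<^sup>2 = (csqrt Q)\<^sup>2"
        using q [of k] by simp
      then show "k \<in> {csqrt Q, - csqrt Q}"
        using power2_eq_iff [of k "csqrt Q"] by auto
    qed
  qed simp
  ultimately have "finite ({k \<in> cball 0 \<rho>. G k = 0} \<union> {k. q k = 0})"
    by blast
  then show ?thesis
    by (rule rev_finite_subset) (auto simp: F)
qed

section \<open>Reduction to a transcendental equation\<close>

lemma filterlim_inverse_square_at_infinity: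
  "filterlim (\<lambda>w::complex. 1 / w\<^sup>2) (at 0) at_infinity"
proof -
  have "filterlim (\<lambda>w::complex. inverse w) (at 0) at_infinity"
    by (simp add: filterlim_at tendsto_inverse_0 eventually_not_equal_at_infinity)
  moreover have "filterlim (\<lambda>w::complex. w\<^sup>2) at_infinity at_infinity"
    by (rule filterlim_power_at_infinity) simp
  ultimately show ?thesis
    using filterlim_compose by (force simp: inverse_eq_divide)
qed

text \<open>With \<open>v = 1 / w\<^sup>2\<close>, the product \<open>w * \<eta> w\<close> is
  \<open>M v / v + (N v / v) / w\<close>. The first quotient tends to the derivative of
  \<open>M\<close> at 0; the second converges as well, so its product with \<open>1 / w\<close>
  tends to 0.\<close>

lemma substitute_inverse_square:
  fixes M N :: "complex \<Rightarrow> complex" and c :: complex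
  assumes M: "M analytic_on {0}" "M 0 = 0" "(M has_field_derivative c) (at 0)"
    and N: "N analytic_on {0}" "N 0 = 0"
  defines "\<eta> \<equiv> (\<lambda>w. w * M (1 / w\<^sup>2) + N (1 / w\<^sup>2))"
  obtains R where "\<eta> holomorphic_on {w. R < norm w}" "((\<lambda>w. w * \<eta> w) \<longlongrightarrow> c) at_infinity"
proof -
  note v_lim = filterlim_inverse_square_at_infinity
  obtain S where S: "open S" "0 \<in> S" "M holomorphic_on S" "N holomorphic_on S"
    using M(1) N(1) analytic_at_two by blast
  have "\<forall>\<^sub>F v in at 0. v \<in> S"
    using S by (simp add: eventually_at_in_open')
  with v_lim have "\<forall>\<^sub>F w in at_infinity. 1 / (w::complex)\<^sup>2 \<in> S"
    by (rule eventually_compose_filterlim [rotated])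
  then obtain R where R: "\<And>w::complex. norm w \<ge> R \<Longrightarrow> 1 / w\<^sup>2 \<in> S"
    by (auto simp: eventually_at_infinity)
  \<comment> \<open>The absolute value keeps \<open>w = 0\<close> out of the domain.\<close>
  have comp: "(\<lambda>w. f (1 / w\<^sup>2)) holomorphic_on {w. \<bar>R\<bar> < norm w}" if "f holomorphic_on S" for f
  proof -
    have "(f \<circ> (\<lambda>w. 1 / w\<^sup>2)) holomorphic_on {w. \<bar>R\<bar> < norm w}"
      by (rule holomorphic_on_compose_gen [OF _ that]) (auto intro!: holomorphic_intros R)
    then show ?thesis
      by (simp add: o_def)
  qed
  have "\<eta> holomorphic_on {w. \<bar>R\<bar> < norm w}"
    unfolding \<eta>_def by (intro holomorphic_intros comp S)
  moreover have "((\<lambda>w. w * \<eta> w) \<longlongrightarrow> c) at_infinity"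
  proof -
    obtain c' where "(N has_field_derivative c') (at 0)"
      using N(1) analytic_on_imp_differentiable_at field_differentiable_def by blast
    then have "((\<lambda>w. N (1 / w\<^sup>2) / (1 / w\<^sup>2)) \<longlongrightarrow> c') at_infinity"
      using filterlim_compose [OF _ v_lim, of "\<lambda>v. N v / v"] N(2)
      by (simp add: has_field_derivative_iff)
    then have "((\<lambda>w. N (1 / w\<^sup>2) / (1 / w\<^sup>2) * inverse w) \<longlongrightarrow> c' * 0) at_infinity"
      by (intro tendsto_mult tendsto_inverse_0)
    moreover have "((\<lambda>w. M (1 / w\<^sup>2) / (1 / w\<^sup>2)) \<longlongrightarrow> c) at_infinity"
      using filterlim_compose [OF _ v_lim, of "\<lambda>v. M v / v"] M(2,3)
      by (simp add: has_field_derivative_iff)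
    ultimately have "((\<lambda>w. M (1 / w\<^sup>2) / (1 / w\<^sup>2) + N (1 / w\<^sup>2) / (1 / w\<^sup>2) * inverse w) \<longlongrightarrow> c + c' * 0) at_infinity"
      by (intro tendsto_add)
    moreover have "\<forall>\<^sub>F w in at_infinity.
        M (1 / w\<^sup>2) / (1 / w\<^sup>2) + N (1 / w\<^sup>2) / (1 / w\<^sup>2) * inverse w = w * \<eta> w"
      using eventually_not_equal_at_infinity [of 0]
      by eventually_elim (simp add: \<eta>_def field_simps power2_eq_square)
    ultimately show ?thesis
      by (simp add: filterlim_cong)
  qed
  ultimately show thesis
    using that by blast
qed

text \<open>The equation is quadratic in \<open>exp u\<close>, with roots
  \<open>y * (1 + \<rho>)\<close> and \<open>y * (1 - \<rho>)\<close> whose product is -1. As the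
  first has norm at least 2, the second has norm at most 1/2 and is excluded by the bound on
  \<open>exp u\<close>.\<close>

lemma sinh_eq_iff_exp_eq:
  fixes u y \<rho> :: complex
  assumes \<rho>: "y\<^sup>2 * \<rho>\<^sup>2 = y\<^sup>2 + 1" and big: "norm (y * (1 + \<rho>)) \<ge> 2" and u: "norm (exp u) > 1 / 2"
  shows "sinh u = y \<longleftrightarrow> exp u = y * (1 + \<rho>)"
proof -
  have "sinh u = y \<longleftrightarrow> exp u * (sinh u * 2 - y * 2) = 0"
    by simp
  also have "exp u * (sinh u * 2 - y * 2) = (exp u - y * (1 + \<rho>)) * (exp u - y * (1 - \<rho>))"
    using \<rho> by (simp add: sinh_field_def exp_minus field_simps power2_eq_square)
  also have "\<dots> = 0 \<longleftrightarrow> exp u = y * (1 + \<rho>)"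
  proof -
    have "y * (1 + \<rho>) * (y * (1 - \<rho>)) = - 1"
      using \<rho> by (simp add: algebra_simps power2_eq_square)
    then have "norm (y * (1 + \<rho>)) * norm (y * (1 - \<rho>)) = 1"
      by (metis norm_minus_cancel norm_mult norm_one)
    moreover have "norm (y * (1 + \<rho>)) * norm (y * (1 - \<rho>)) \<ge> 2 * norm (y * (1 - \<rho>))"
      by (intro mult_right_mono big) auto
    ultimately have "norm (y * (1 - \<rho>)) \<le> 1 / 2"
      by linarith
    then have "exp u \<noteq> y * (1 - \<rho>)"
      using u by (metis leD)
    then show ?thesis
      by simp
  qed
  finally show ?thesis .
qed

text \<open>The terms in \<open>w ^ 4\<close> cancel in the first coefficient up to order
  \<open>w\<^sup>2\<close>, whereas the second has order \<open>w ^ 4\<close> and multiplies a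
  \<open>sinh\<close> of order \<open>1 / w\<close>. The quotient therefore gives
  \<open>sinh u = - (s * w * G v)\<close> with \<open>v = 1 / w\<^sup>2\<close>, and the preceding
  lemma selects one root. The sign \<open>s\<close> covers both symmetry types at once.\<close>

lemma dispersion_reduction:
  fixes \<kappa> \<mu> :: complex
  assumes "\<kappa> \<noteq> \<mu>"
  obtains \<eta> :: "complex \<Rightarrow> complex" and R :: real where
    "\<eta> holomorphic_on {w. R < norm w}" "((\<lambda>w. w * \<eta> w) \<longlongrightarrow> (\<kappa> + \<mu>) / 4) at_infinity"
    "\<And>w s a b. \<lbrakk>R < norm w; Re w \<ge> 0; s\<^sup>2 = 1; a = csqrt (1 - \<kappa> / w\<^sup>2); b = csqrt (1 - \<mu> / w\<^sup>2)\<rbrakk> \<Longrightarrow>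
       ((\<kappa> - 2 * w\<^sup>2)\<^sup>2 - 4 * w ^ 4 * a * b) * sinh (w * (a + b) / 2)
       + s * ((\<kappa> - 2 * w\<^sup>2)\<^sup>2 + 4 * w ^ 4 * a * b) * sinh (w * (a - b) / 2) = 0
       \<longleftrightarrow> exp w = - 2 * s * w * exp (\<eta> w)"
proof -
  obtain S :: "complex \<Rightarrow> complex" where S: "S holomorphic_on UNIV" "S 0 = 1" "\<And>z. sin z = z * S (z\<^sup>2)"
    using sinc_entire_even by metis
  have sinh_S: "sinh z = z * S (- (z\<^sup>2))" for z
    using S(3) [of "\<i> * z"] by (simp add: sinh_conv_sin power_mult_distrib mult.assoc)
  define a where "a = (\<lambda>v. csqrt (1 - \<kappa> * v))"
  define b where "b = (\<lambda>v. csqrt (1 - \<mu> * v))"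
  \<comment> \<open>\<open>A\<close> and \<open>B\<close> are the two coefficients divided by
    \<open>w\<^sup>2\<close> and \<open>w ^ 4\<close>, as functions of \<open>v\<close>. Writing
    \<open>1 - a v * b v\<close> as a quotient with denominator \<open>1 + a v * b v\<close> makes
    the cancellation explicit, so that \<open>A\<close> is visibly analytic at 0.\<close>
  define A where "A = (\<lambda>v. \<kappa>\<^sup>2 * v - 4 * \<kappa> + 4 * (\<kappa> + \<mu> - \<kappa> * \<mu> * v) / (1 + a v * b v))"
  define B where "B = (\<lambda>v. (\<kappa> * v - 2)\<^sup>2 + 4 * a v * b v)"
  define S1 where "S1 = (\<lambda>v. S (- ((\<kappa> - \<mu>)\<^sup>2 * v / (4 * (a v + b v)\<^sup>2))))"
  define G where "G = (\<lambda>v. - ((\<kappa> - \<mu>) * B v * S1 v / (2 * (a v + b v) * A v)))"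
  \<comment> \<open>For \<open>y = - (s * w * G v)\<close> the quantity
    \<open>1 + 1 / y\<^sup>2\<close> is \<open>1 + v / (G v)\<^sup>2\<close>; \<open>\<rho>\<close>
    is its square root, and the selected root \<open>y * (1 + \<rho> v)\<close> equals
    \<open>- 2 * s * w * D v\<close>.\<close>
  define \<rho> where "\<rho> = (\<lambda>v. csqrt (1 + v / (G v)\<^sup>2))"
  define D where "D = (\<lambda>v. G v * (1 + \<rho> v) / 2)"
  \<comment> \<open>\<open>w * M v\<close> is the amount by which
    \<open>u = w * (a v + b v) / 2\<close> falls short of \<open>w\<close>.\<close>
  define M where "M = (\<lambda>v. 1 - (a v + b v) / 2)"
  have at0: "a 0 = 1" "b 0 = 1" "A 0 = - 2 * (\<kappa> - \<mu>)" "B 0 = 8" "S1 0 = 1" "M 0 = 0"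
    by (simp_all add: a_def b_def A_def B_def S1_def M_def S)
  \<comment> \<open>Here \<open>\<kappa> \<noteq> \<mu>\<close> enters: the factor
    \<open>\<kappa> - \<mu>\<close> in the numerator of \<open>G 0\<close> cancels against the one
    in \<open>A 0\<close>.\<close>
  have "- (d * 8 * 1 / (2 * (1 + 1) * (- 2 * d))) = 1" if "d \<noteq> 0" for d :: complex
    using that by simp
  from this [of "\<kappa> - \<mu>"] have G0: "G 0 = 1"
    unfolding G_def at0 using assms by simp
  then have \<rho>0: "\<rho> 0 = 1" and D0: "D 0 = 1"
    by (simp_all add: \<rho>_def D_def)
  have ana_ab: "a analytic_on {0}" "b analytic_on {0}"
    unfolding a_def b_def by (auto intro!: analytic_intros)
  have ana_A: "A analytic_on {0}" and ana_B: "B analytic_on {0}"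
    unfolding A_def B_def by (auto intro!: analytic_intros ana_ab simp: at0)
  have "(S \<circ> (\<lambda>v. - ((\<kappa> - \<mu>)\<^sup>2 * v / (4 * (a v + b v)\<^sup>2)))) analytic_on {0}"
    by (rule analytic_on_compose_gen [of _ _ _ UNIV])
       (auto intro!: analytic_intros ana_ab simp: at0 analytic_on_open S)
  then have ana_S1: "S1 analytic_on {0}"
    by (simp add: S1_def o_def)
  have ana_G: "G analytic_on {0}"
    unfolding G_def by (auto intro!: analytic_intros ana_ab ana_A ana_B ana_S1 simp: at0 assms assms [symmetric])
  have ana_\<rho>: "\<rho> analytic_on {0}"
    unfolding \<rho>_def by (auto intro!: analytic_intros ana_G simp: G0)
  have ana_D: "D analytic_on {0}"
    unfolding D_def by (auto intro!: analytic_intros ana_G ana_\<rho>)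
  have ana_LnD: "(\<lambda>v. Ln (D v)) analytic_on {0}"
    by (auto intro!: analytic_intros ana_D simp: D0)
  have ana_M: "M analytic_on {0}"
    unfolding M_def by (auto intro!: analytic_intros ana_ab)
  have M': "(M has_field_derivative (\<kappa> + \<mu>) / 4) (at 0)"
    unfolding M_def a_def b_def by (auto intro!: derivative_eq_intros simp: field_simps)
  define \<eta> where "\<eta> = (\<lambda>w. w * M (1 / w\<^sup>2) + Ln (D (1 / w\<^sup>2)))"
  obtain R where R: "\<eta> holomorphic_on {w. R < norm w}"
    and lim: "((\<lambda>w. w * \<eta> w) \<longlongrightarrow> (\<kappa> + \<mu>) / 4) at_infinity"
    unfolding \<eta>_def
    by (rule substitute_inverse_square [OF ana_M at0(6) M' ana_LnD]) (simp_all add: D0)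

  have v_lim: "((\<lambda>w. f (1 / w\<^sup>2)) \<longlongrightarrow> f 0) at_infinity" if "f analytic_on {0}" for f :: "complex \<Rightarrow> complex"
    using analytic_at_imp_isCont [OF that] filterlim_inverse_square_at_infinity
    unfolding isCont_def by (rule filterlim_compose)
  have wM_lim: "((\<lambda>w. w * M (1 / w\<^sup>2)) \<longlongrightarrow> 0) at_infinity"
  proof -
    have "((\<lambda>w. M (1 / w\<^sup>2) / (1 / w\<^sup>2) * inverse w) \<longlongrightarrow> (\<kappa> + \<mu>) / 4 * 0) at_infinity"
      using filterlim_compose [OF _ filterlim_inverse_square_at_infinity, of "\<lambda>v. M v / v"] M' at0(6)
      by (intro tendsto_mult tendsto_inverse_0) (simp add: has_field_derivative_iff)
    moreover have "\<forall>\<^sub>F w in at_infinity. M (1 / w\<^sup>2) / (1 / w\<^sup>2) * inverse w = w * M (1 / w\<^sup>2)"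
      using eventually_not_equal_at_infinity [of 0]
      by eventually_elim (simp add: field_simps power2_eq_square)
    ultimately show ?thesis
      unfolding mult_zero_right by (rule Lim_transform_eventually)
  qed
  \<comment> \<open>Besides nonzero denominators, these conditions provide the two bounds that
    separate the roots: \<open>2 * norm w * norm (D v) \<ge> 2\<close> for the large root, and
    \<open>norm (w * M v) < 1 / 2\<close> for the lower bound on \<open>Re u\<close>.\<close>
  have "\<forall>\<^sub>F w in at_infinity. w \<noteq> 0 \<and> norm w > 2 \<and> norm (w * M (1 / w\<^sup>2)) < 1 / 2 \<and>
      norm (D (1 / w\<^sup>2)) > 1 / 2 \<and> A (1 / w\<^sup>2) \<noteq> 0 \<and> G (1 / w\<^sup>2) \<noteq> 0 \<and>
      a (1 / w\<^sup>2) + b (1 / w\<^sup>2) \<noteq> 0 \<and> 1 + a (1 / w\<^sup>2) * b (1 / w\<^sup>2) \<noteq> 0"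
  proof (intro eventually_conj)
    show "\<forall>\<^sub>F w::complex in at_infinity. norm w > 2"
      by (auto simp: eventually_at_infinity intro: exI [of _ 3])
    show "\<forall>\<^sub>F w in at_infinity. norm (w * M (1 / w\<^sup>2)) < 1 / 2"
      by (rule order_tendstoD(2) [OF tendsto_norm_zero [OF wM_lim]]) simp
    show "\<forall>\<^sub>F w in at_infinity. norm (D (1 / w\<^sup>2)) > 1 / 2"
      by (rule order_tendstoD(1) [OF tendsto_norm [OF v_lim [OF ana_D]]]) (simp add: D0)
    show "\<forall>\<^sub>F w in at_infinity. A (1 / w\<^sup>2) \<noteq> 0"
      by (rule tendsto_imp_eventually_ne [OF v_lim [OF ana_A]]) (simp add: at0 assms assms [symmetric])
    show "\<forall>\<^sub>F w in at_infinity. G (1 / w\<^sup>2) \<noteq> 0"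
      by (rule tendsto_imp_eventually_ne [OF v_lim [OF ana_G]]) (simp add: G0)
    show "\<forall>\<^sub>F w in at_infinity. a (1 / w\<^sup>2) + b (1 / w\<^sup>2) \<noteq> 0"
      by (rule tendsto_imp_eventually_ne [OF tendsto_add [OF v_lim [OF ana_ab(1)] v_lim [OF ana_ab(2)]]])
         (simp add: at0)
    show "\<forall>\<^sub>F w in at_infinity. 1 + a (1 / w\<^sup>2) * b (1 / w\<^sup>2) \<noteq> 0"
      by (rule tendsto_imp_eventually_ne [OF tendsto_add [OF tendsto_const
            tendsto_mult [OF v_lim [OF ana_ab(1)] v_lim [OF ana_ab(2)]]]])
         (simp add: at0)
  qed (rule eventually_not_equal_at_infinity)
  then obtain R' where R': "\<And>w. norm w \<ge> R' \<Longrightarrow> w \<noteq> 0 \<and> norm w > 2 \<and> norm (w * M (1 / w\<^sup>2)) < 1 / 2 \<and>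
      norm (D (1 / w\<^sup>2)) > 1 / 2 \<and> A (1 / w\<^sup>2) \<noteq> 0 \<and> G (1 / w\<^sup>2) \<noteq> 0 \<and>
      a (1 / w\<^sup>2) + b (1 / w\<^sup>2) \<noteq> 0 \<and> 1 + a (1 / w\<^sup>2) * b (1 / w\<^sup>2) \<noteq> 0"
    unfolding eventually_at_infinity by blast

  have equiv: "((\<kappa> - 2 * w\<^sup>2)\<^sup>2 - 4 * w ^ 4 * a' * b') * sinh (w * (a' + b') / 2)
       + s * ((\<kappa> - 2 * w\<^sup>2)\<^sup>2 + 4 * w ^ 4 * a' * b') * sinh (w * (a' - b') / 2) = 0
       \<longleftrightarrow> exp w = - 2 * s * w * exp (\<eta> w)" (is "?lhs \<longleftrightarrow> ?rhs")
    if w: "max R R' < norm w" "Re w \<ge> 0" and s: "s\<^sup>2 = 1"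
      and ab': "a' = csqrt (1 - \<kappa> / w\<^sup>2)" "b' = csqrt (1 - \<mu> / w\<^sup>2)" for w s a' b'
  proof -
    define v where "v = 1 / w\<^sup>2"
    have ab: "a' = a v" "b' = b v"
      by (simp_all add: ab' a_def b_def v_def)
    have nz: "w \<noteq> 0" "norm w > 2" "norm (w * M v) < 1 / 2" "norm (D v) > 1 / 2" "A v \<noteq> 0" "G v \<noteq> 0"
      "a v + b v \<noteq> 0" "1 + a v * b v \<noteq> 0"
      using R' [of w] w(1) unfolding v_def by auto
    have wv: "w\<^sup>2 * v = 1"
      using nz(1) by (simp add: v_def)
    have a2: "(a v)\<^sup>2 = 1 - \<kappa> * v" and b2: "(b v)\<^sup>2 = 1 - \<mu> * v"
      by (simp_all add: a_def b_def)
    have A_eq: "(\<kappa> - 2 * w\<^sup>2)\<^sup>2 - 4 * w ^ 4 * a v * b v = w\<^sup>2 * A v"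
    proof -
      have "(1 - a v * b v) * (1 + a v * b v) = 1 - (1 - \<kappa> * v) * (1 - \<mu> * v)"
        unfolding a2 [symmetric] b2 [symmetric] by (simp add: algebra_simps power2_eq_square)
      also have "\<dots> = (\<kappa> + \<mu> - \<kappa> * \<mu> * v) * v"
        by (simp add: algebra_simps)
      finally have "1 - a v * b v = (\<kappa> + \<mu> - \<kappa> * \<mu> * v) / (1 + a v * b v) * v"
        using nz(8) by (simp add: field_simps)
      then have "w\<^sup>2 * (1 - a v * b v) = (\<kappa> + \<mu> - \<kappa> * \<mu> * v) / (1 + a v * b v)"
        using wv by (metis mult.commute mult.left_commute mult.right_neutral)
      then have A_v: "A v = \<kappa>\<^sup>2 * v - 4 * \<kappa> + 4 * (w\<^sup>2 * (1 - a v * b v))"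
        unfolding A_def by simp
      have "w\<^sup>2 * A v = \<kappa>\<^sup>2 * (w\<^sup>2 * v) - 4 * \<kappa> * w\<^sup>2 + 4 * w\<^sup>2 * (w\<^sup>2 * (1 - a v * b v))"
        unfolding A_v by (simp add: algebra_simps)
      then show ?thesis
        unfolding wv by (simp add: algebra_simps power2_eq_square power4_eq_xxxx)
    qed
    have B_eq: "(\<kappa> - 2 * w\<^sup>2)\<^sup>2 + 4 * w ^ 4 * a v * b v = w ^ 4 * B v"
    proof -
      have "w ^ 4 * B v = (\<kappa> * (w\<^sup>2 * v) - 2 * w\<^sup>2)\<^sup>2 + 4 * w ^ 4 * a v * b v"
        by (simp add: B_def algebra_simps power2_eq_square power4_eq_xxxx)
      then show ?thesis
        unfolding wv by simp
    qed
    have ab_diff: "a v - b v = - ((\<kappa> - \<mu>) * v / (a v + b v))"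
    proof -
      have "(a v - b v) * (a v + b v) = - ((\<kappa> - \<mu>) * v)"
        using a2 b2 by (simp add: algebra_simps power2_eq_square)
      then show ?thesis
        using nz(7) by (simp add: field_simps)
    qed
    \<comment> \<open>As \<open>a v - b v\<close> has order \<open>v\<close>, the squared argument
      depends on \<open>v\<close> alone once \<open>w\<^sup>2 * v = 1\<close> is used. The extra
      factor \<open>w\<close> compensates the order \<open>1 / w\<close> of the
      \<open>sinh\<close>.\<close>
    have sinh_diff: "w * sinh (w * (a v - b v) / 2) = - ((\<kappa> - \<mu>) / (2 * (a v + b v)) * S1 v)"
    proof -
      have "(w * (a v - b v) / 2)\<^sup>2 = (w\<^sup>2 * v) * ((\<kappa> - \<mu>)\<^sup>2 * v / (4 * (a v + b v)\<^sup>2))"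
      proof -
        have "(w * (a v - b v) / 2)\<^sup>2 = w\<^sup>2 * (a v - b v)\<^sup>2 / 4"
          by (simp add: power_mult_distrib power_divide)
        also have "(a v - b v)\<^sup>2 = (\<kappa> - \<mu>)\<^sup>2 * v\<^sup>2 / (a v + b v)\<^sup>2"
          unfolding ab_diff by (simp add: power_mult_distrib power_divide)
        finally show ?thesis
          by (simp add: power2_eq_square [of v] mult_ac)
      qed
      then have "S (- ((w * (a v - b v) / 2)\<^sup>2)) = S1 v"
        unfolding wv S1_def by simp
      then have "w * sinh (w * (a v - b v) / 2) = w * (w * (a v - b v) / 2) * S1 v"
        unfolding sinh_S by simp
      moreover have "w * (w * - (x * v / c) / 2) = - ((w\<^sup>2 * v) * (x / (2 * c)))" for x c
        by (simp add: power2_eq_square mult_ac)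
      then have "w * (w * (a v - b v) / 2) = - ((w\<^sup>2 * v) * ((\<kappa> - \<mu>) / (2 * (a v + b v))))"
        unfolding ab_diff .
      ultimately show ?thesis
        by (simp only: wv mult_1 mult_minus_left)
    qed
    define u where "u = w * (a v + b v) / 2"
    define y where "y = - (s * w * G v)"
    have Gy: "w\<^sup>2 * A v * y = w ^ 3 * s * B v * ((\<kappa> - \<mu>) / (2 * (a v + b v)) * S1 v)"
    proof -
      have "w\<^sup>2 * A0 * - (s * w * - (d * B0 * S0 / (2 * c * A0))) = w ^ 3 * s * B0 * (d / (2 * c) * S0)"
        if "A0 \<noteq> 0" for A0 B0 S0 c d
        using that by (simp add: power2_eq_square power3_eq_cube)
      from this [OF nz(5)] show ?thesis
        unfolding y_def G_def .
    qed
    have "w\<^sup>2 * A v * sinh u + s * (w ^ 4 * B v) * sinh (w * (a v - b v) / 2)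
        = w\<^sup>2 * A v * sinh u + s * w ^ 3 * B v * (w * sinh (w * (a v - b v) / 2))"
      by (simp add: power3_eq_cube power4_eq_xxxx)
    also have "\<dots> = w\<^sup>2 * A v * sinh u - w ^ 3 * s * B v * ((\<kappa> - \<mu>) / (2 * (a v + b v)) * S1 v)"
      unfolding sinh_diff by (simp only: mult_minus_right add_uminus_conv_diff mult_ac)
    also have "\<dots> = w\<^sup>2 * A v * (sinh u - y)"
      unfolding Gy [symmetric] by (rule right_diff_distrib [symmetric])
    finally have "?lhs \<longleftrightarrow> sinh u = y"
      unfolding ab A_eq B_eq u_def [symmetric] using nz(1,5) by simp
    also have "\<dots> \<longleftrightarrow> exp u = y * (1 + \<rho> v)"
    proof (rule sinh_eq_iff_exp_eq)
      have "y\<^sup>2 = w\<^sup>2 * (G v)\<^sup>2"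
        using s by (simp add: y_def power_mult_distrib)
      moreover have "(\<rho> v)\<^sup>2 = 1 + v / (G v)\<^sup>2"
        by (simp add: \<rho>_def)
      ultimately show "y\<^sup>2 * (\<rho> v)\<^sup>2 = y\<^sup>2 + 1"
        using nz(6) wv by (simp add: field_simps)
      have "norm s = 1"
        using s by (metis norm_ge_zero norm_one norm_power power2_eq_1_iff abs_norm_cancel abs_1 abs_minus_cancel)
      have "y * (1 + \<rho> v) = - (2 * s * w * D v)"
        by (simp add: y_def D_def)
      then have "norm (y * (1 + \<rho> v)) = 2 * norm w * norm (D v)"
        using \<open>norm s = 1\<close> by (simp add: norm_mult)
      also have "\<dots> \<ge> 2 * 2 * (1 / 2)"
        using nz by (intro mult_mono) auto
      finally show "norm (y * (1 + \<rho> v)) \<ge> 2"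
        by simp
      \<comment> \<open>\<open>Re w \<ge> 0\<close> passes to \<open>u\<close> with an error below
        1/2, and \<open>exp x \<ge> 1 + x\<close> then keeps \<open>norm (exp u)\<close> above the
        small root.\<close>
      have "u = w - w * M v"
        by (simp add: u_def M_def field_simps)
      then have "Re u > - 1 / 2"
        using w(2) nz(3) abs_Re_le_cmod [of "w * M v"] by (simp add: abs_le_iff)
      then show "norm (exp u) > 1 / 2"
        unfolding norm_exp_eq_Re using exp_ge_add_one_self [of "Re u"] by linarith
    qed
    also have "y * (1 + \<rho> v) = - 2 * s * w * exp (Ln (D v))"
    proof -
      have "D v \<noteq> 0"
        using nz(4) by auto
      then show ?thesis
        by (simp add: y_def D_def)
    qed
    \<comment> \<open>Multiplication by \<open>exp (w * M v)\<close> turns \<open>exp u\<close> into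
      \<open>exp w\<close> and completes the exponent \<open>\<eta> w\<close> on the right.\<close>
    also have "exp u = - 2 * s * w * exp (Ln (D v)) \<longleftrightarrow> exp u * exp (w * M v) = - 2 * s * w * exp (Ln (D v)) * exp (w * M v)"
      by (rule mult_right_cancel [OF exp_not_eq_zero, symmetric])
    also have "exp u * exp (w * M v) = exp w"
      by (simp add: u_def M_def field_simps flip: exp_add)
    also have "- 2 * s * w * exp (Ln (D v)) * exp (w * M v) = - 2 * s * w * exp (\<eta> w)"
      by (simp add: \<eta>_def v_def exp_add)
    finally show ?thesis .
  qed
  have "\<eta> holomorphic_on {w. max R R' < norm w}"
    using R by (rule holomorphic_on_subset) auto
  then show thesis
    using lim equiv by (rule that)
qed

section \<open>The transcendental equation\<close>

text \<open>Banach's fixed point theorem on the closed half plane \<open>B \<le> Im w\<close>, which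
  avoids the branch cut of \<open>Ln\<close>. There the derivative of \<open>Ln\<close> is at most
  1/4 in norm and, by Cauchy's inequality on unit circles, that of \<open>\<eta>\<close> at most
  1/8, so each \<open>T n\<close> contracts by the factor 1/2.\<close>

lemma transcendental_fixpoint:
  fixes \<eta> :: "complex \<Rightarrow> complex" and c :: complex and R \<theta> :: real
  assumes hol: "\<eta> holomorphic_on {w. R < norm w}"
    and lim: "((\<lambda>w. w * \<eta> w) \<longlongrightarrow> c) at_infinity"
  defines "T \<equiv> (\<lambda>(n::nat) w. of_real (ln 2) + Ln w + \<eta> w + \<i> * of_real (pi * (2 * real n - \<theta>)))"
  obtains B :: real and n0 :: nat where "B > R" "B \<ge> 4" "n0 \<ge> 1"
    "\<And>w. norm w \<ge> B \<Longrightarrow> norm (\<eta> w) \<le> 1 / 8"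
    "\<And>n. n \<ge> n0 \<Longrightarrow> \<exists>!w. w \<in> {w. B \<le> Im w} \<and> T n w = w"
proof -
  have "((\<lambda>w. (w * \<eta> w) * inverse w) \<longlongrightarrow> c * 0) at_infinity"
    by (intro tendsto_mult lim tendsto_inverse_0)
  moreover have "\<forall>\<^sub>F w in at_infinity. (w * \<eta> w) * inverse w = \<eta> w"
    using eventually_not_equal_at_infinity [of 0] by eventually_elim (simp add: field_simps)
  ultimately have "(\<eta> \<longlongrightarrow> 0) at_infinity"
    by (simp add: filterlim_cong)
  then have "\<forall>\<^sub>F w in at_infinity. norm (\<eta> w) < 1 / 8"
    by (rule order_tendstoD [OF tendsto_norm_zero]) simp
  then obtain r where r: "\<And>w. norm w \<ge> r \<Longrightarrow> norm (\<eta> w) < 1 / 8"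
    by (auto simp: eventually_at_infinity)
  \<comment> \<open>Points of norm at least \<open>B\<close> have their whole closed unit disc in
    the region where \<open>\<eta>\<close> is holomorphic and small; the summand 4 also gives
    \<open>1 / norm w \<le> 1 / 4\<close>.\<close>
  define B where "B = \<bar>R\<bar> + \<bar>r\<bar> + 4"
  have \<eta>_le: "norm (\<eta> w) \<le> 1 / 8" if "norm w \<ge> B" for w
  proof -
    have "r \<le> norm w"
      using that by (simp add: B_def)
    then show ?thesis
      using r [of w] by linarith
  qed
  have \<eta>_deriv: "\<exists>D. (\<eta> has_field_derivative D) (at w) \<and> norm D \<le> 1 / 8" if "norm w \<ge> B" for w
  proof -
    have big: "R < norm x \<and> r \<le> norm x" if "x \<in> cball w 1" for x
      using that norm_triangle_ineq2 [of w x] \<open>norm w \<ge> B\<close> by (auto simp: B_def dist_norm)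
    have "open {w::complex. R < norm w}"
      by (intro open_Collect_less continuous_intros)
    then have "(\<eta> has_field_derivative deriv \<eta> w) (at w)"
      using holomorphic_derivI [OF hol] big [of w] by auto
    moreover have hol': "\<eta> holomorphic_on cball w 1"
      using hol big by (auto intro: holomorphic_on_subset)
    have "norm ((deriv ^^ 1) \<eta> w) \<le> fact 1 * (1 / 8) / 1 ^ 1"
    proof (rule Cauchy_inequality)
      show "norm (\<eta> x) \<le> 1 / 8" if "norm (w - x) = 1" for x
        using that big [of x] r [of x] by (auto simp: dist_norm)
    qed (use hol' in \<open>auto intro: holomorphic_on_subset holomorphic_on_imp_continuous_on\<close>)
    ultimately show ?thesis
      by auto
  qed
  define H where "H = {w::complex. B \<le> Im w}"
  have H_norm: "norm w \<ge> B" if "w \<in> H" for w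
    using that abs_Im_le_cmod [of w] by (simp add: H_def)
  have "B \<ge> 4"
    by (simp add: B_def)
  have H: "complete H" "H \<noteq> {}" "convex H"
  proof -
    show "complete H"
      unfolding H_def complete_eq_closed by (intro closed_Collect_le continuous_intros)
    have "\<i> * of_real B \<in> H"
      by (simp add: H_def)
    then show "H \<noteq> {}"
      by blast
    show "convex H"
      unfolding H_def by (rule convex_halfspace_Im_ge)
  qed
  have lip: "norm (T n x - T n y) \<le> (1 / 2) * norm (x - y)" if "x \<in> H" "y \<in> H" for x y n
  proof -
    have "\<exists>D. (T n has_field_derivative D) (at w within H) \<and> norm D \<le> 1 / 2" if w: "w \<in> H" for w
    proof -
      obtain D where D: "(\<eta> has_field_derivative D) (at w)" "norm D \<le> 1 / 8"
        using \<eta>_deriv H_norm w by blast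
      have "w \<notin> \<real>\<^sub>\<le>\<^sub>0"
        using w \<open>B \<ge> 4\<close> by (auto simp: H_def complex_nonpos_Reals_iff)
      then have "(T n has_field_derivative (inverse w + D)) (at w)"
        unfolding T_def by (auto intro!: derivative_eq_intros D)
      moreover have "norm (inverse w) \<le> inverse 4"
        unfolding norm_inverse using H_norm [OF w] \<open>B \<ge> 4\<close> by (intro le_imp_inverse_le) auto
      then have "norm (inverse w + D) \<le> inverse 4 + 1 / 8"
        using D(2) by (rule norm_triangle_mono)
      ultimately show ?thesis
        by (intro exI [of _ "inverse w + D"]) (auto intro: has_field_derivative_at_within)
    qed
    then obtain D where "\<And>w. w \<in> H \<Longrightarrow> (T n has_field_derivative D w) (at w within H)"
        "\<And>w. w \<in> H \<Longrightarrow> norm (D w) \<le> 1 / 2"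
      by metis
    then show ?thesis
      using field_differentiable_bound [OF H(3), of "T n" D] that by blast
  qed
  \<comment> \<open>This choice ensures \<open>pi * (2 * real n - \<theta>) \<ge> B + 1\<close>.
    Since \<open>Im (Ln w) > 0\<close> and \<open>Im (\<eta> w) \<ge> - 1\<close>, the half plane is
    mapped into itself.\<close>
  define n0 where "n0 = nat \<lceil>B + 1 + \<bar>\<theta>\<bar> * pi\<rceil> + 1"
  have maps: "T n ` H \<subseteq> H" if n: "n \<ge> n0" for n
  proof clarify
    fix w assume w: "w \<in> H"
    have "B + 1 + \<bar>\<theta>\<bar> * pi \<le> real n"
      using n unfolding n0_def by linarith
    also have "\<dots> \<le> 2 * pi * real n"
      using pi_gt3 by (simp add: mult_le_cancel_right1)
    finally have "B + 1 + \<bar>\<theta>\<bar> * pi \<le> 2 * pi * real n" .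
    moreover have "\<theta> * pi \<le> \<bar>\<theta>\<bar> * pi"
      by (intro mult_right_mono) auto
    moreover have "pi * (2 * real n - \<theta>) = 2 * pi * real n - \<theta> * pi"
      by (simp add: algebra_simps)
    ultimately have "B + 1 \<le> pi * (2 * real n - \<theta>)"
      by linarith
    moreover have "0 < Im w"
      using w \<open>B \<ge> 4\<close> by (simp add: H_def)
    then have "0 < Im (Ln w)"
      using Im_Ln_pos_lt_imp by blast
    moreover have "\<bar>Im (\<eta> w)\<bar> \<le> 1"
      using \<eta>_le [OF H_norm [OF w]] abs_Im_le_cmod [of "\<eta> w"] by linarith
    ultimately show "T n w \<in> H"
      by (simp add: H_def T_def)
  qed
  have fix_ex: "\<exists>!w. w \<in> H \<and> T n w = w" if "n \<ge> n0" for n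
    by (rule Banach_fix [OF H(1,2), of "1 / 2"]) (use maps lip that in \<open>auto simp: dist_norm\<close>)
  show thesis
  proof (rule that [of B n0])
    show "B > R" "n0 \<ge> 1"
      by (auto simp: B_def n0_def)
  qed (use \<open>B \<ge> 4\<close> \<eta>_le fix_ex in \<open>auto simp: H_def\<close>)
qed

text \<open>Let \<open>W n = u n + d n\<close> with \<open>u n = 2 * pi * \<i> * n\<close>. The
  equation first gives \<open>d = O(ln n)\<close>; inserting this into
  \<open>Ln (W n) = Ln (u n) + Ln (1 + \<delta> n)\<close> gives \<open>d = E0 + r\<close> with
  \<open>r = O(ln n / n)\<close>. A second insertion, now with the linear term of
  \<open>Ln (1 + \<delta> n)\<close> kept, yields the terms of order \<open>ln n / n\<close> and
  \<open>1 / n\<close>.\<close>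

lemma fixpoint_asymptotics:
  fixes \<eta> :: "complex \<Rightarrow> complex" and c :: complex and \<theta> :: real and W :: "nat \<Rightarrow> complex"
  assumes lim: "((\<lambda>w. w * \<eta> w) \<longlongrightarrow> c) at_infinity"
    and W: "\<And>n. n \<ge> n0 \<Longrightarrow>
      W n = of_real (ln 2) + Ln (W n) + \<eta> (W n) + \<i> * of_real (pi * (2 * real n - \<theta>))"
    and \<eta>_le: "\<And>n. n \<ge> n0 \<Longrightarrow> norm (\<eta> (W n)) \<le> 1"
    and W_large: "\<And>n. n \<ge> n0 \<Longrightarrow> 4 \<le> Im (W n)"
  shows "(\<lambda>n. W n - (of_real (ln (4 * pi * real n)) + \<i> * of_real (pi * (2 * real n + 1 / 2 - \<theta>))
           - \<i> * of_real (ln (4 * pi * real n) / (2 * pi * real n)) + of_real ((1 / 2 - \<theta>) / (2 * real n))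
           - \<i> * c / of_real (2 * pi * real n)))
         \<in> o(\<lambda>n. 1 / of_nat n)"
proof -
  define u where "u = (\<lambda>n. 2 * of_real pi * \<i> * of_nat n :: complex)"
  define d where "d = (\<lambda>n. W n - u n)"
  define \<delta> where "\<delta> = (\<lambda>n. d n / u n)"
  define E0 where "E0 = (\<lambda>n. of_real (ln (4 * pi * real n)) + \<i> * of_real (pi * (1 / 2 - \<theta>)) :: complex)"
  define e1 where "e1 = (\<lambda>n. Ln (1 + \<delta> n) - \<delta> n)"
  define r where "r = (\<lambda>n. \<delta> n + e1 n + \<eta> (W n))"
  have ev0: "\<forall>\<^sub>F n in sequentially. n \<ge> n0"
    by (rule eventually_ge_at_top)
  have ln_le: "ln x \<le> x / 2" if "x \<ge> 4" for x :: real
  proof -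
    have "ln (x / 2) \<le> x / 2 - 1"
      using that by (intro ln_le_minus_one) auto
    moreover have "ln (x / 2) = ln x - ln 2"
      using that by (simp add: ln_div)
    ultimately show ?thesis
      using ln_le_minus_one [of 2] by simp
  qed

  \<comment> \<open>Logarithmic bound on the correction \<open>d\<close>\<close>
  have Im_d: "\<bar>Im (d n)\<bar> \<le> pi * (1 + \<bar>\<theta>\<bar>) + 1" if n: "n \<ge> n0" for n
  proof -
    have "Im (d n) = Im (Ln (W n)) + Im (\<eta> (W n)) - pi * \<theta>"
      using arg_cong [OF W [OF n], of Im] by (simp add: d_def u_def algebra_simps)
    moreover have "\<bar>Im (Ln (W n))\<bar> \<le> pi"
      using Im_Ln_le_pi [of "W n"] mpi_less_Im_Ln [of "W n"] W_large [OF n] by fastforce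
    moreover have "\<bar>Im (\<eta> (W n))\<bar> \<le> 1"
      using \<eta>_le [OF n] abs_Im_le_cmod order_trans by blast
    moreover have "\<bar>pi * \<theta>\<bar> = pi * \<bar>\<theta>\<bar>"
      by (simp add: abs_mult)
    ultimately show ?thesis
      by (simp add: algebra_simps)
  qed
  define C where "C = pi * (1 + \<bar>\<theta>\<bar>) + 1"
  have Re_eq: "Re (d n) = ln 2 + ln (norm (W n)) + Re (\<eta> (W n))" if n: "n \<ge> n0" for n
  proof -
    have "W n \<noteq> 0"
      using W_large [OF n] by auto
    then show ?thesis
      using arg_cong [OF W [OF n], of Re] by (simp add: d_def u_def)
  qed
  have norm_W: "norm (W n) \<ge> 4" if "n \<ge> n0" for n
    using W_large [OF that] abs_Im_le_cmod [of "W n"] by linarith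
  \<comment> \<open>The real part is at most \<open>2 + ln (norm (W n))\<close> in absolute value.
    By \<open>ln x \<le> x / 2\<close> this logarithm is absorbed into the left-hand side, which
    leaves a linear bound in \<open>n\<close>.\<close>
  have W_le: "norm (W n) \<le> 2 * (C + 2 * pi * real n + 2)" if n: "n \<ge> n0" for n
  proof -
    have "Re (W n) = Re (d n)"
      by (simp add: d_def u_def)
    then have "\<bar>Re (W n)\<bar> \<le> 1 + ln (norm (W n)) + 1"
      using Re_eq [OF n] \<eta>_le [OF n] abs_Re_le_cmod [of "\<eta> (W n)"] ln_le_minus_one [of 2]
        ln_ge_zero [of 2] ln_ge_zero [of "norm (W n)"] norm_W [OF n] by linarith
    moreover have "\<bar>Im (W n)\<bar> \<le> C + 2 * pi * real n"
    proof -
      have "Im (W n) = Im (d n) + 2 * pi * real n"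
        by (simp add: d_def u_def)
      moreover have "0 \<le> 2 * pi * real n"
        by simp
      ultimately show ?thesis
        using Im_d [OF n] unfolding C_def by linarith
    qed
    ultimately have "norm (W n) / 2 \<le> C + 2 * pi * real n + 2"
      using ln_le [OF norm_W [OF n]] cmod_le [of "W n"] by linarith
    then show ?thesis
      by simp
  qed
  have d_le: "norm (d n) \<le> C + 2 + ln (2 * (C + 2 * pi * real n + 2))" if n: "n \<ge> n0" for n
  proof -
    have "ln (norm (W n)) \<le> ln (2 * (C + 2 * pi * real n + 2))"
      using W_le [OF n] norm_W [OF n] by (intro ln_mono) auto
    then have "\<bar>Re (d n)\<bar> \<le> 2 + ln (2 * (C + 2 * pi * real n + 2))"
      using Re_eq [OF n] \<eta>_le [OF n] abs_Re_le_cmod [of "\<eta> (W n)"] ln_le_minus_one [of 2]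
        ln_ge_zero [of 2] ln_ge_zero [of "norm (W n)"] norm_W [OF n] by linarith
    then show ?thesis
      using Im_d [OF n] cmod_le [of "d n"] unfolding C_def by linarith
  qed
  have "C > 0"
    unfolding C_def by (intro add_nonneg_pos mult_nonneg_nonneg) auto
  have d_bigo: "d \<in> O(\<lambda>n. of_real (ln (real n)))"
  proof -
    have "d \<in> O(\<lambda>n. of_real (C + 2 + ln (2 * (C + 2 * pi * real n + 2))))"
    proof (rule bigoI [of _ 1], use ev0 in eventually_elim)
      case (elim n)
      show ?case
        unfolding norm_of_real mult_1 by (rule order_trans [OF d_le [OF elim] abs_ge_self])
    qed
    also have "(\<lambda>n. of_real (C + 2 + ln (2 * (C + 2 * pi * real n + 2)))) \<in> O(\<lambda>n. of_real (ln (real n)) :: complex)"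
      unfolding landau_o.big.of_real_iff using \<open>C > 0\<close> by real_asymp
    finally show ?thesis .
  qed

  \<comment> \<open>Orders of the error terms\<close>
  have inv_u: "(\<lambda>n. 1 / u n) \<in> O(\<lambda>n. of_real (1 / real n))"
    by (rule bigoI [of _ 1], use eventually_gt_at_top [of 0] in eventually_elim)
       (use pi_gt3 in \<open>simp add: u_def norm_mult norm_divide divide_simps\<close>)
  have \<delta>_bigo: "\<delta> \<in> O(\<lambda>n. of_real (ln (real n) / real n))"
    using landau_o.big.mult [OF d_bigo inv_u] by (simp add: \<delta>_def)
  have "(\<lambda>n. of_real (ln (real n) / real n)) \<in> o(\<lambda>n. of_real 1 :: complex)"
    unfolding landau_o.small.of_real_iff by real_asymp
  with \<delta>_bigo have "\<delta> \<in> o(\<lambda>n. of_real 1)"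
    by (rule landau_o.big_small_trans)
  then have \<delta>_lim: "\<delta> \<longlonglongrightarrow> 0"
    by (auto dest: smalloD_tendsto)
  have \<delta>_small: "\<forall>\<^sub>F n in sequentially. norm (\<delta> n) < 1 / 2"
    using order_tendstoD(2) [OF tendsto_norm_zero [OF \<delta>_lim], of "1 / 2"] by simp
  have e1_bigo: "e1 \<in> O(\<lambda>n. of_real ((ln (real n) / real n)\<^sup>2))"
  proof -
    have "e1 \<in> O(\<lambda>n. (\<delta> n)\<^sup>2)"
    proof (rule bigoI [of _ 2], use \<delta>_small in eventually_elim)
      case (elim n)
      then have "norm (e1 n) \<le> (norm (\<delta> n))\<^sup>2 / (1 - norm (\<delta> n))"
        unfolding e1_def by (intro Ln_approx_linear) auto
      also have "\<dots> \<le> (norm (\<delta> n))\<^sup>2 / (1 / 2)"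
        using elim by (intro divide_left_mono) auto
      finally show ?case
        by (simp add: norm_power)
    qed
    also have "(\<lambda>n. (\<delta> n)\<^sup>2) \<in> O(\<lambda>n. (of_real (ln (real n) / real n))\<^sup>2)"
      using landau_o.big.mult [OF \<delta>_bigo \<delta>_bigo] by (simp add: power2_eq_square)
    finally show ?thesis
      by simp
  qed
  have W_u: "(\<lambda>n. W n / u n) \<longlonglongrightarrow> 1"
  proof -
    have "(\<lambda>n. 1 + \<delta> n) \<longlonglongrightarrow> 1 + 0"
      by (intro tendsto_intros \<delta>_lim)
    moreover have "\<forall>\<^sub>F n in sequentially. 1 + \<delta> n = W n / u n"
      using eventually_gt_at_top [of 0]
      by eventually_elim (simp add: \<delta>_def d_def u_def field_simps)
    ultimately show ?thesis
      by (simp add: filterlim_cong)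
  qed
  have W_inf: "filterlim W at_infinity sequentially"
  proof -
    have "filterlim u at_infinity sequentially"
      unfolding u_def
      by (rule tendsto_mult_filterlim_at_infinity [OF tendsto_const _ tendsto_of_nat]) simp
    then have "filterlim (\<lambda>n. W n / u n * u n) at_infinity sequentially"
      by (intro tendsto_mult_filterlim_at_infinity [OF W_u]) auto
    moreover have "\<forall>\<^sub>F n in sequentially. W n / u n * u n = W n"
      using eventually_gt_at_top [of 0] by eventually_elim (simp add: u_def)
    ultimately show ?thesis
      by (simp add: filterlim_cong)
  qed
  \<comment> \<open>Because \<open>W n * \<eta> (W n)\<close> tends to \<open>c\<close> and
    \<open>W n / u n\<close> tends to 1, replacing \<open>\<eta> (W n)\<close> by
    \<open>c / u n\<close> costs only \<open>o(1 / n)\<close>.\<close>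
  define e2 where "e2 = (\<lambda>n. \<eta> (W n) - c / u n)"
  have e2_lim: "(\<lambda>n. e2 n * u n) \<longlonglongrightarrow> 0"
  proof -
    have "(\<lambda>n. W n * \<eta> (W n)) \<longlonglongrightarrow> c"
      using filterlim_compose [OF lim W_inf] .
    then have "(\<lambda>n. (W n * \<eta> (W n)) / (W n / u n) - c) \<longlonglongrightarrow> c / 1 - c"
      by (intro tendsto_intros W_u) auto
    moreover have "\<forall>\<^sub>F n in sequentially. (W n * \<eta> (W n)) / (W n / u n) - c = e2 n * u n"
      using eventually_gt_at_top [of 0] ev0
    proof eventually_elim
      case (elim n)
      then have "W n \<noteq> 0" "u n \<noteq> 0"
        using W_large [of n] by (auto simp: u_def)
      then show ?case
        by (simp add: e2_def field_simps)
    qed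
    ultimately show ?thesis
      by (simp add: filterlim_cong)
  qed
  have e2_o: "e2 \<in> o(\<lambda>n. of_real (1 / real n))"
  proof (rule smalloI_tendsto)
    have "(\<lambda>n. e2 n * u n / (2 * of_real pi * \<i>)) \<longlonglongrightarrow> 0 / (2 * of_real pi * \<i>)"
      by (intro tendsto_intros e2_lim) auto
    then show "(\<lambda>n. e2 n / of_real (1 / real n)) \<longlonglongrightarrow> 0"
      by (simp add: u_def field_simps)
    show "\<forall>\<^sub>F n in sequentially. complex_of_real (1 / real n) \<noteq> 0"
      using eventually_gt_at_top [of 0] by eventually_elim simp
  qed
  have \<eta>_bigo: "(\<lambda>n. \<eta> (W n)) \<in> O(\<lambda>n. of_real (1 / real n))"
  proof -
    have "(\<lambda>n. c * (1 / u n)) \<in> O(\<lambda>n. of_real (1 / real n))"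
      using landau_o.big.mult [OF bigo_const [of c] inv_u] by simp
    then have "(\<lambda>n. e2 n + c / u n) \<in> O(\<lambda>n. of_real (1 / real n))"
      using sum_in_bigo(1) [OF landau_o.small_imp_big [OF e2_o]] by simp
    then show ?thesis
      by (simp add: e2_def)
  qed
  have r_bigo: "r \<in> O(\<lambda>n. of_real (ln (real n) / real n))"
  proof -
    have "(\<lambda>n. of_real ((ln (real n) / real n)\<^sup>2)) \<in> O(\<lambda>n. of_real (ln (real n) / real n) :: complex)"
      unfolding landau_o.big.of_real_iff by real_asymp
    moreover have "(\<lambda>n. of_real (1 / real n)) \<in> O(\<lambda>n. of_real (ln (real n) / real n) :: complex)"
      unfolding landau_o.big.of_real_iff by real_asymp
    ultimately show ?thesis
      unfolding r_def using \<delta>_bigo e1_bigo \<eta>_bigo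
      by (intro sum_in_bigo) (auto intro: landau_o.big_trans)
  qed
  have r_u: "(\<lambda>n. r n / u n) \<in> o(\<lambda>n. of_real (1 / real n))"
  proof -
    have "(\<lambda>n. r n / u n) \<in> O(\<lambda>n. of_real (ln (real n) / real n * (1 / real n)))"
      using landau_o.big.mult [OF r_bigo inv_u] by simp
    also have "(\<lambda>n. of_real (ln (real n) / real n * (1 / real n))) \<in> o(\<lambda>n. of_real (1 / real n) :: complex)"
      unfolding landau_o.small.of_real_iff by real_asymp
    finally show ?thesis .
  qed
  have e1_o: "e1 \<in> o(\<lambda>n. of_real (1 / real n))"
  proof -
    have "(\<lambda>n. of_real ((ln (real n) / real n)\<^sup>2)) \<in> o(\<lambda>n. of_real (1 / real n) :: complex)"
      unfolding landau_o.small.of_real_iff by real_asymp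
    with e1_bigo show ?thesis
      by (rule landau_o.big_small_trans)
  qed

  \<comment> \<open>Two insertions into the fixed point equation\<close>
  have d_eq: "\<forall>\<^sub>F n in sequentially. d n = E0 n + r n"
    using eventually_gt_at_top [of 0] ev0 \<delta>_small
  proof eventually_elim
    case (elim n)
    have un: "u n = \<i> * of_real (2 * pi * real n)"
      by (simp add: u_def)
    have pos: "2 * pi * real n > 0"
      using elim by simp
    have Lnu: "Ln (u n) = of_real (ln (2 * pi * real n)) + \<i> * of_real pi / 2"
      unfolding un using Ln_times_ii [of "of_real (2 * pi * real n)"] Ln_of_real [OF pos] elim(1)
      by (simp del: of_real_mult)
    have "\<bar>Re (\<delta> n)\<bar> < 1 / 2"
      using elim(3) abs_Re_le_cmod order_le_less_trans by blast
    then have Re1: "Re (1 + \<delta> n) > 0"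
      by simp
    have "1 + \<delta> n \<noteq> 0"
      using Re1 by (metis less_irrefl zero_complex.sel(1))
    \<comment> \<open>The argument of \<open>u n\<close> is \<open>pi / 2\<close>, so adding one
      below \<open>pi / 2\<close> in absolute value stays within the principal branch and
      \<open>Ln\<close> is additive.\<close>
    have "\<bar>Im (Ln (1 + \<delta> n))\<bar> < pi / 2"
      using Re_Ln_pos_lt [OF \<open>1 + \<delta> n \<noteq> 0\<close>] Re1 by blast
    moreover have "Im (Ln (u n)) = pi / 2"
      by (simp add: Lnu)
    moreover have "u n \<noteq> 0"
      using elim(1) by (simp add: u_def)
    ultimately have "Ln (u n * (1 + \<delta> n)) = Ln (u n) + Ln (1 + \<delta> n)"
      using \<open>1 + \<delta> n \<noteq> 0\<close> by (intro Ln_times_simple) (simp_all add: abs_less_iff)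
    moreover have "u n * (1 + \<delta> n) = W n"
      using elim by (simp add: \<delta>_def d_def field_simps u_def)
    ultimately have "W n = of_real (ln 2) + (of_real (ln (2 * pi * real n)) + \<i> * of_real pi / 2) + Ln (1 + \<delta> n)
        + \<eta> (W n) + \<i> * of_real (pi * (2 * real n - \<theta>))"
      using W [OF elim(2)] Lnu by (simp add: add.assoc)
    moreover have "ln (4 * pi * real n) = ln 2 + ln (2 * pi * real n)"
      using pos ln_mult_pos [of 2 "2 * pi * real n"] by (simp add: mult.assoc)
    ultimately show ?case
      by (simp add: d_def E0_def r_def e1_def u_def algebra_simps)
  qed
  have "(\<lambda>n. e1 n + e2 n + r n / u n) \<in> o(\<lambda>n. of_real (1 / real n))"
    by (intro sum_in_smallo e1_o e2_o r_u)
  moreover have "\<forall>\<^sub>F n in sequentially. e1 n + e2 n + r n / u n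
      = W n - (of_real (ln (4 * pi * real n)) + \<i> * of_real (pi * (2 * real n + 1 / 2 - \<theta>))
           - \<i> * of_real (ln (4 * pi * real n) / (2 * pi * real n)) + of_real ((1 / 2 - \<theta>) / (2 * real n))
           - \<i> * c / of_real (2 * pi * real n))"
    using eventually_gt_at_top [of 0] d_eq
  proof eventually_elim
    case (elim n)
    \<comment> \<open>The second insertion: \<open>E0 n / u n\<close> contributes to the expansion,
      while \<open>r n / u n\<close> has order \<open>ln n / n^2\<close> and joins the
      error.\<close>
    have "\<delta> n = E0 n / u n + r n / u n"
      by (simp add: \<delta>_def elim add_divide_distrib)
    then have "W n = u n + E0 n + E0 n / u n + c / u n + (e1 n + e2 n + r n / u n)"
      using elim(2) by (simp add: d_def r_def e2_def algebra_simps)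
    moreover have "c / u n = - \<i> * c / of_real (2 * pi * real n)"
      using elim(1) by (simp add: u_def field_simps)
    moreover have "E0 n / u n = - \<i> * of_real (ln (4 * pi * real n) / (2 * pi * real n)) + of_real ((1 / 2 - \<theta>) / (2 * real n))"
      using elim(1) by (simp add: E0_def u_def field_simps)
    moreover have "u n + E0 n = of_real (ln (4 * pi * real n)) + \<i> * of_real (pi * (2 * real n + 1 / 2 - \<theta>))"
      by (simp add: u_def E0_def algebra_simps)
    ultimately show ?case
      by simp
  qed
  ultimately show ?thesis
    by (simp add: landau_o.small.in_cong)
qed

text \<open>Fixed points are roots because \<open>exp (T n w)\<close> is the right-hand side of the
  equation for every \<open>n\<close>. Conversely, a root \<open>w\<close> satisfies
  \<open>w = T m w\<close> for some integer \<open>m\<close> by periodicity of \<open>exp\<close>.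
  For large \<open>w\<close> in the closed quadrant, \<open>Re w\<close> is only logarithmic in
  \<open>norm w\<close>, so \<open>Im w\<close> is large; this places \<open>w\<close> in the half
  plane of uniqueness and forces \<open>m \<ge> n0\<close>.\<close>

lemma transcendental_roots:
  fixes \<eta> :: "complex \<Rightarrow> complex" and c :: complex and R \<theta> :: real
  assumes hol: "\<eta> holomorphic_on {w. R < norm w}"
    and lim: "((\<lambda>w. w * \<eta> w) \<longlongrightarrow> c) at_infinity"
  defines "is_root \<equiv> (\<lambda>w. exp w = 2 * w * exp (\<eta> w - \<i> * of_real (pi * \<theta>)))"
  obtains W :: "nat \<Rightarrow> complex" and n0 :: nat and B :: real where
    "n0 \<ge> 1" "inj_on W {n0..}"
    "\<And>n. n \<ge> n0 \<Longrightarrow> norm (W n) > R \<and> Re (W n) > 0 \<and> Im (W n) > 0 \<and> is_root (W n)"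
    "\<And>w. norm w \<ge> B \<Longrightarrow> Re w \<ge> 0 \<Longrightarrow> Im w \<ge> 0 \<Longrightarrow> is_root w \<Longrightarrow> w \<in> W ` {n0..}"
    "(\<lambda>n. W n - (of_real (ln (4 * pi * real n)) + \<i> * of_real (pi * (2 * real n + 1 / 2 - \<theta>))
           - \<i> * of_real (ln (4 * pi * real n) / (2 * pi * real n)) + of_real ((1 / 2 - \<theta>) / (2 * real n))
           - \<i> * c / of_real (2 * pi * real n)))
         \<in> o(\<lambda>n. 1 / of_nat n)"
proof -
  define T where "T = (\<lambda>(n::nat) w. of_real (ln 2) + Ln w + \<eta> w + \<i> * of_real (pi * (2 * real n - \<theta>)))"
  obtain B n0 where B: "B > R" "B \<ge> 4" and "n0 \<ge> 1"
    and \<eta>_le: "\<And>w. norm w \<ge> B \<Longrightarrow> norm (\<eta> w) \<le> 1 / 8"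
    and fixpoint: "\<And>n. n \<ge> n0 \<Longrightarrow> \<exists>!w. w \<in> {w. B \<le> Im w} \<and> T n w = w"
    unfolding T_def by (rule transcendental_fixpoint [OF hol lim, of \<theta>]) blast
  define W where "W = (\<lambda>n. THE w. w \<in> {w. B \<le> Im w} \<and> T n w = w)"
  have W: "B \<le> Im (W n)" "T n (W n) = W n" if "n \<ge> n0" for n
    using theI' [OF fixpoint [OF that]] by (auto simp: W_def)
  have W_unique: "w = W n" if "n \<ge> n0" "B \<le> Im w" "T n w = w" for n w
    unfolding W_def using the1_equality [OF fixpoint [OF that(1)], of w] that by simp
  have norm_W: "norm (W n) \<ge> B" if "n \<ge> n0" for n
    using W(1) [OF that] abs_Im_le_cmod [of "W n"] by linarith

  have exp_T: "exp (T n w) = 2 * w * exp (\<eta> w - \<i> * of_real (pi * \<theta>))" if "w \<noteq> 0" for n w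
  proof -
    have "T n w = (of_real (ln 2) + Ln w) + (\<eta> w - \<i> * of_real (pi * \<theta>)) + of_nat n * (2 * of_real pi * \<i>)"
      by (simp add: T_def algebra_simps)
    then show ?thesis
      using that exp_of_real [of "ln 2", where 'a = complex]
      by (simp only: exp_add exp_of_nat_mult) simp
  qed

  \<comment> \<open>At a common point the maps \<open>T m\<close> and \<open>T n\<close> differ by
    \<open>2 * pi * \<i> * (m - n)\<close>.\<close>
  have inj: "inj_on W {n0..}"
  proof (rule inj_onI)
    fix m n assume mn: "m \<in> {n0..}" "n \<in> {n0..}" "W m = W n"
    then have "Im (T m (W m)) = Im (T n (W m))"
      using W(2) [of m] W(2) [of n] by simp
    then show "m = n"
      by (simp add: T_def)
  qed

  have W_root: "norm (W n) > R \<and> Re (W n) > 0 \<and> Im (W n) > 0 \<and> is_root (W n)" if n: "n \<ge> n0" for n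
  proof -
    have "W n \<noteq> 0"
      using W(1) [OF n] B by auto
    have "Re (W n) = ln 2 + ln (norm (W n)) + Re (\<eta> (W n))"
      using arg_cong [OF W(2) [OF n], of Re] \<open>W n \<noteq> 0\<close> by (simp add: T_def)
    moreover have "\<bar>Re (\<eta> (W n))\<bar> \<le> 1 / 8"
      using \<eta>_le [OF norm_W [OF n]] abs_Re_le_cmod order_trans by blast
    moreover have "ln 2 \<ge> (1 / 2 :: real)"
      using ln_le_minus_one [of "1 / 2"] by (simp add: ln_div)
    moreover have "ln (norm (W n)) \<ge> 0"
      using norm_W [OF n] B by simp
    ultimately have "Re (W n) > 0"
      by linarith
    moreover have "is_root (W n)"
      using exp_T [OF \<open>W n \<noteq> 0\<close>, of n] W(2) [OF n] by (simp add: is_root_def)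
    ultimately show ?thesis
      using norm_W [OF n] W(1) [OF n] B by auto
  qed

  have "\<forall>\<^sub>F x :: real in at_top. ln (4 * x) \<le> x / 2"
    by real_asymp
  then obtain X where X: "\<And>x :: real. x \<ge> X \<Longrightarrow> ln (4 * x) \<le> x / 2"
    by (auto simp: eventually_at_top_linorder)
  \<comment> \<open>Chosen so that \<open>Im w \<ge> N + 1\<close> forces \<open>m \<ge> n0\<close>:
    the summand with \<open>\<theta>\<close> absorbs the phase, the last \<open>2 * pi\<close>
    absorbs \<open>Im (Ln w) \<le> pi\<close>, and the extra 1 absorbs
    \<open>Im (\<eta> w)\<close>.\<close>
  define N where "N = 2 * pi * (real n0 + \<bar>\<theta>\<bar> + 1)"
  have "N \<ge> 0"
    by (simp add: N_def)
  define B' where "B' = \<bar>X\<bar> + 2 * B + 2 * N + 2"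
  have cover: "w \<in> W ` {n0..}" if w: "norm w \<ge> B'" "Re w \<ge> 0" "Im w \<ge> 0" "is_root w" for w
  proof -
    have w_large: "norm w \<ge> X" "norm w \<ge> 2 * B" "norm w \<ge> 2 * N + 2"
      using w(1) B \<open>N \<ge> 0\<close> unfolding B'_def by linarith+
    have "norm w \<ge> B"
      using w_large(2) B by linarith
    have "norm w > 0"
      using w_large(2) B by linarith
    then have "w \<noteq> 0"
      by auto
    have \<eta>w: "\<bar>Re (\<eta> w)\<bar> \<le> 1 / 8" "\<bar>Im (\<eta> w)\<bar> \<le> 1 / 8"
      using \<eta>_le [OF \<open>norm w \<ge> B\<close>] abs_Re_le_cmod [of "\<eta> w"] abs_Im_le_cmod [of "\<eta> w"] by linarith+
    \<comment> \<open>Taking norms in the equation gives \<open>Re w \<le> ln (4 * norm w)\<close>,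
      hence at most \<open>norm w / 2\<close>; the imaginary part then accounts for at least the
      other half of \<open>norm w\<close>.\<close>
    have "exp (Re w) = norm (2 * w * exp (\<eta> w - \<i> * of_real (pi * \<theta>)))"
      using w(4) by (metis norm_exp_eq_Re is_root_def)
    also have "\<dots> = 2 * norm w * exp (Re (\<eta> w))"
      by (simp add: norm_mult)
    also have "\<dots> \<le> 2 * norm w * 2"
    proof (intro mult_left_mono)
      have "exp (Re (\<eta> w)) \<le> exp (1 / 2)"
        using \<eta>w by simp
      also have "\<dots> \<le> 2"
        using exp_half_le2 .
      finally show "exp (Re (\<eta> w)) \<le> 2" .
    qed simp
    finally have "Re w \<le> ln (4 * norm w)"
      using \<open>norm w > 0\<close> by (subst ln_ge_iff) auto
    then have "Re w \<le> norm w / 2"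
      using X [OF w_large(1)] by linarith
    then have Im_w: "Im w \<ge> norm w / 2"
      using cmod_le [of w] w(2,3) by linarith
    then have "Im w \<ge> B"
      using w_large(2) by linarith
    have "exp w = exp (T 0 w)"
      using w(4) exp_T [OF \<open>w \<noteq> 0\<close>, of 0] by (simp add: is_root_def)
    then obtain m :: int where m: "w = T 0 w + (of_int (2 * m) * pi) * \<i>"
      by (auto simp: exp_eq)
    have "Im w = Im (Ln w) + Im (\<eta> w) - pi * \<theta> + 2 * pi * of_int m"
      using arg_cong [OF m, of Im] by (simp add: T_def algebra_simps)
    moreover have "Im (Ln w) \<le> pi"
      using Im_Ln_le_pi \<open>w \<noteq> 0\<close> by blast
    moreover have "pi * (- \<theta>) \<le> pi * (2 * \<bar>\<theta>\<bar>)"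
      by (intro mult_left_mono) auto
    then have "- (pi * \<theta>) \<le> 2 * pi * \<bar>\<theta>\<bar>"
      by (simp add: mult_ac)
    ultimately have "N \<le> 2 * pi * of_int m + pi + 2 * pi * \<bar>\<theta>\<bar>"
      using Im_w w_large(3) \<eta>w(2) by linarith
    moreover have "N = 2 * pi * real n0 + 2 * pi * \<bar>\<theta>\<bar> + 2 * pi"
      by (simp add: N_def algebra_simps)
    ultimately have "2 * pi * real n0 \<le> 2 * pi * of_int m"
      using pi_gt_zero by linarith
    then have "real n0 \<le> of_int m"
      by simp
    then have "m \<ge> int n0"
      by linarith
    then obtain n where n: "m = int n" "n \<ge> n0"
      using nonneg_int_cases [of m] by auto
    have "T n w = w"
      using m n(1) by (simp add: T_def algebra_simps)
    then show ?thesis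
      using W_unique [OF n(2) \<open>Im w \<ge> B\<close>] n(2) by auto
  qed

  have asymp: "(\<lambda>n. W n - (of_real (ln (4 * pi * real n)) + \<i> * of_real (pi * (2 * real n + 1 / 2 - \<theta>))
           - \<i> * of_real (ln (4 * pi * real n) / (2 * pi * real n)) + of_real ((1 / 2 - \<theta>) / (2 * real n))
           - \<i> * c / of_real (2 * pi * real n)))
         \<in> o(\<lambda>n. 1 / of_nat n)"
  proof (rule fixpoint_asymptotics [OF lim])
    fix n assume n: "n \<ge> n0"
    show "W n = of_real (ln 2) + Ln (W n) + \<eta> (W n) + \<i> * of_real (pi * (2 * real n - \<theta>))"
      using W(2) [OF n] by (simp add: T_def)
    show "norm (\<eta> (W n)) \<le> 1"
      using \<eta>_le [OF norm_W [OF n]] by linarith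
    show "4 \<le> Im (W n)"
      using W(1) [OF n] B by linarith
  qed
  show thesis
    using that [OF \<open>n0 \<ge> 1\<close> inj W_root cover asymp] .
qed

section \<open>The Rayleigh--Lamb equations\<close>

text \<open>By independence of the signs of the roots, \<open>p\<close> and \<open>q\<close> may be
  replaced by \<open>\<i> * k * b\<close> and \<open>\<i> * k * a\<close>, which turns sines and
  cosines into hyperbolic functions. Scaling by \<open>(2 * h) ^ 4\<close> and the addition theorems
  then give the two forms.\<close>

lemma rayleigh_lamb_iff_sinh:
  fixes h kt kl :: real and p q k :: complex
  assumes "h > 0" "k \<noteq> 0"
    and p: "p\<^sup>2 = of_real (kl\<^sup>2) - k\<^sup>2" and q: "q\<^sup>2 = of_real (kt\<^sup>2) - k\<^sup>2"
  defines "\<kappa> \<equiv> of_real ((2 * h * kt)\<^sup>2)" and "\<mu> \<equiv> of_real ((2 * h * kl)\<^sup>2)" and "w \<equiv> of_real (2 * h) * k"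
  defines "a \<equiv> csqrt (1 - \<kappa> / w\<^sup>2)" and "b \<equiv> csqrt (1 - \<mu> / w\<^sup>2)"
  shows "rayleigh_lamb_sym h p q k \<longleftrightarrow>
       ((\<kappa> - 2 * w\<^sup>2)\<^sup>2 - 4 * w ^ 4 * a * b) * sinh (w * (a + b) / 2)
       + 1 * ((\<kappa> - 2 * w\<^sup>2)\<^sup>2 + 4 * w ^ 4 * a * b) * sinh (w * (a - b) / 2) = 0"
    and "rayleigh_lamb_antisym h p q k \<longleftrightarrow>
       ((\<kappa> - 2 * w\<^sup>2)\<^sup>2 - 4 * w ^ 4 * a * b) * sinh (w * (a + b) / 2)
       + (- 1) * ((\<kappa> - 2 * w\<^sup>2)\<^sup>2 + 4 * w ^ 4 * a * b) * sinh (w * (a - b) / 2) = 0"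
proof -
  have "w \<noteq> 0"
    using assms by simp
  define p' q' where "p' = \<i> * k * b" and "q' = \<i> * k * a"
  have "k\<^sup>2 * (\<kappa> / w\<^sup>2) = of_real (kt\<^sup>2)" "k\<^sup>2 * (\<mu> / w\<^sup>2) = of_real (kl\<^sup>2)"
    using assms by (simp_all add: power_mult_distrib)
  then have "p'\<^sup>2 = p\<^sup>2" and q'2: "q'\<^sup>2 = q\<^sup>2"
    unfolding p'_def q'_def p q a_def b_def by (simp_all add: power_mult_distrib algebra_simps)
  then have signs: "rayleigh_lamb_sym h p q k \<longleftrightarrow> rayleigh_lamb_sym h p' q' k"
    "rayleigh_lamb_antisym h p q k \<longleftrightarrow> rayleigh_lamb_antisym h p' q' k"
    using rayleigh_lamb_sign_indep by blast+
  define \<alpha> where "\<alpha> = (\<kappa> - 2 * w\<^sup>2)\<^sup>2"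
  define \<beta> where "\<beta> = 4 * w ^ 4 * a * b"
  have coeffs: "(q'\<^sup>2 - k\<^sup>2)\<^sup>2 = \<alpha> / of_real (2 * h) ^ 4" "4 * k\<^sup>2 * p' * q' = - \<beta> / of_real (2 * h) ^ 4"
  proof -
    have "\<kappa> - 2 * w\<^sup>2 = of_real (2 * h) ^ 2 * (q'\<^sup>2 - k\<^sup>2)"
      unfolding q'2 q by (simp add: \<kappa>_def w_def power_mult_distrib algebra_simps)
    then have "\<alpha> = of_real (2 * h) ^ 4 * (q'\<^sup>2 - k\<^sup>2)\<^sup>2"
      by (simp add: \<alpha>_def power_mult_distrib flip: power_mult)
    then show "(q'\<^sup>2 - k\<^sup>2)\<^sup>2 = \<alpha> / of_real (2 * h) ^ 4"
      using \<open>h > 0\<close> by (simp add: field_simps)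
    have "\<beta> = of_real (2 * h) ^ 4 * - (4 * k\<^sup>2 * p' * q')"
      by (simp add: \<beta>_def w_def p'_def q'_def power_mult_distrib power2_eq_square power4_eq_xxxx mult_ac)
    then show "4 * k\<^sup>2 * p' * q' = - \<beta> / of_real (2 * h) ^ 4"
      using \<open>h > 0\<close> by (simp add: field_simps)
  qed
  have "q' * of_real h = \<i> * (w * a / 2)" "p' * of_real h = \<i> * (w * b / 2)"
    by (simp_all add: p'_def q'_def w_def)
  moreover have "sin (\<i> * z) = \<i> * sinh z" "cos (\<i> * z) = cosh z" for z :: complex
    by (simp_all add: sinh_conv_sin cosh_conv_cos)
  ultimately have trig: "sin (q' * of_real h) = \<i> * sinh (w * a / 2)" "cos (q' * of_real h) = cosh (w * a / 2)"
    "sin (p' * of_real h) = \<i> * sinh (w * b / 2)" "cos (p' * of_real h) = cosh (w * b / 2)"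
    by (simp_all only:)
  have "w * (a + b) / 2 = w * a / 2 + w * b / 2" "w * (a - b) / 2 = w * a / 2 - w * b / 2"
    by (simp_all add: field_simps)
  then have add: "sinh (w * (a + b) / 2) = sinh (w * a / 2) * cosh (w * b / 2) + cosh (w * a / 2) * sinh (w * b / 2)"
    "sinh (w * (a - b) / 2) = sinh (w * a / 2) * cosh (w * b / 2) - cosh (w * a / 2) * sinh (w * b / 2)"
    by (simp_all only: sinh_add sinh_diff)
  \<comment> \<open>With \<open>sa\<close>, \<open>ca\<close>, \<open>sb\<close>, \<open>cb\<close>
    for the hyperbolic values, a product-to-sum rearrangement. Exchanging the roles of
    \<open>a\<close> and \<open>b\<close> in the trigonometric factors reverses only the sign of the
    difference term, whence the sign -1 in the antisymmetric case.\<close>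
  have combine: "\<alpha> / d * (\<i> * sa) * cb + (- \<beta> / d) * (\<i> * sb) * ca
      = \<i> / d / 2 * ((\<alpha> - \<beta>) * (sa * cb + ca * sb) + 1 * (\<alpha> + \<beta>) * (sa * cb - ca * sb))"
    "\<alpha> / d * (\<i> * sb) * ca + (- \<beta> / d) * (\<i> * sa) * cb
      = \<i> / d / 2 * ((\<alpha> - \<beta>) * (sa * cb + ca * sb) + (- 1) * (\<alpha> + \<beta>) * (sa * cb - ca * sb))"
    if "d \<noteq> 0" for d sa ca sb cb
    using that by (simp_all add: field_simps)
  have "complex_of_real (2 * h) ^ 4 \<noteq> 0"
    using \<open>h > 0\<close> by simp
  note combine = combine [OF this]
  have "rayleigh_lamb_sym h p' q' k \<longleftrightarrow>
     \<i> / of_real (2 * h) ^ 4 / 2 * ((\<alpha> - \<beta>) * sinh (w * (a + b) / 2) + 1 * (\<alpha> + \<beta>) * sinh (w * (a - b) / 2)) = 0"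
    unfolding rayleigh_lamb_sym_def coeffs trig add combine(1) ..
  then show "rayleigh_lamb_sym h p q k \<longleftrightarrow>
       ((\<kappa> - 2 * w\<^sup>2)\<^sup>2 - 4 * w ^ 4 * a * b) * sinh (w * (a + b) / 2)
       + 1 * ((\<kappa> - 2 * w\<^sup>2)\<^sup>2 + 4 * w ^ 4 * a * b) * sinh (w * (a - b) / 2) = 0"
    unfolding signs \<alpha>_def \<beta>_def using \<open>h > 0\<close> by simp
  have "rayleigh_lamb_antisym h p' q' k \<longleftrightarrow>
     \<i> / of_real (2 * h) ^ 4 / 2 * ((\<alpha> - \<beta>) * sinh (w * (a + b) / 2) + (- 1) * (\<alpha> + \<beta>) * sinh (w * (a - b) / 2)) = 0"
    unfolding rayleigh_lamb_antisym_def coeffs trig add combine(2) ..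
  then show "rayleigh_lamb_antisym h p q k \<longleftrightarrow>
       ((\<kappa> - 2 * w\<^sup>2)\<^sup>2 - 4 * w ^ 4 * a * b) * sinh (w * (a + b) / 2)
       + (- 1) * ((\<kappa> - 2 * w\<^sup>2)\<^sup>2 + 4 * w ^ 4 * a * b) * sinh (w * (a - b) / 2) = 0"
    unfolding signs \<alpha>_def \<beta>_def using \<open>h > 0\<close> by simp
qed

text \<open>Transfer from \<open>w\<close> to \<open>k = w / (2 * h)\<close> for both symmetry
  types: the sign in \<open>exp w = - 2 * s * w * exp (\<eta> w)\<close> is moved into the exponent
  as the phase \<open>- \<i> * pi * \<theta>\<close>. Solutions outside a disc are covered by the
  sequence, and those inside are finite in number by \<open>fin\<close>.\<close>

lemma enumeration_of_roots:
  fixes sol :: "complex \<Rightarrow> bool" and h \<theta> :: real and \<kappa> \<mu> s :: complex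
  assumes "h > 0" "\<kappa> \<noteq> \<mu>" and s: "s\<^sup>2 = 1" "s = - exp (- (\<i> * of_real (pi * \<theta>)))"
    and sol: "\<And>k w a b. \<lbrakk>k \<noteq> 0; w = of_real (2 * h) * k; a = csqrt (1 - \<kappa> / w\<^sup>2); b = csqrt (1 - \<mu> / w\<^sup>2)\<rbrakk> \<Longrightarrow>
       sol k \<longleftrightarrow> ((\<kappa> - 2 * w\<^sup>2)\<^sup>2 - 4 * w ^ 4 * a * b) * sinh (w * (a + b) / 2)
                 + s * ((\<kappa> - 2 * w\<^sup>2)\<^sup>2 + 4 * w ^ 4 * a * b) * sinh (w * (a - b) / 2) = 0"
    and fin: "\<And>\<rho> k0. \<not> sol k0 \<Longrightarrow> finite {k \<in> cball 0 \<rho>. sol k}"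
  shows "\<exists>n0 \<ge> 1. \<exists>k. enumerates_up_to_finite k n0 {z. sol z \<and> Re z \<ge> 0 \<and> Im z \<ge> 0} \<and>
    (\<lambda>n. k n - (of_real (ln (4 * pi * real n)) + \<i> * of_real (pi * (2 * real n + 1 / 2 - \<theta>))
           - \<i> * of_real (ln (4 * pi * real n) / (2 * pi * real n)) + of_real ((1 / 2 - \<theta>) / (2 * real n))
           - \<i> * ((\<kappa> + \<mu>) / 4) / of_real (2 * pi * real n)) / of_real (2 * h))
         \<in> o(\<lambda>n. 1 / of_nat n)"
proof -
  obtain \<eta> R where hol: "\<eta> holomorphic_on {w. R < norm w}"
    and lim: "((\<lambda>w. w * \<eta> w) \<longlongrightarrow> (\<kappa> + \<mu>) / 4) at_infinity"
    and red: "\<And>w s a b. \<lbrakk>R < norm w; Re w \<ge> 0; s\<^sup>2 = 1; a = csqrt (1 - \<kappa> / w\<^sup>2); b = csqrt (1 - \<mu> / w\<^sup>2)\<rbrakk> \<Longrightarrow>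
       ((\<kappa> - 2 * w\<^sup>2)\<^sup>2 - 4 * w ^ 4 * a * b) * sinh (w * (a + b) / 2)
       + s * ((\<kappa> - 2 * w\<^sup>2)\<^sup>2 + 4 * w ^ 4 * a * b) * sinh (w * (a - b) / 2) = 0
       \<longleftrightarrow> exp w = - 2 * s * w * exp (\<eta> w)"
    by (rule dispersion_reduction [OF \<open>\<kappa> \<noteq> \<mu>\<close>]) (rule that)
  have sol_iff: "sol k \<longleftrightarrow> exp w = 2 * w * exp (\<eta> w - \<i> * of_real (pi * \<theta>))"
    if "w = of_real (2 * h) * k" "norm w > R" "w \<noteq> 0" "Re w \<ge> 0" for k w
  proof -
    have "sol k \<longleftrightarrow> exp w = - 2 * s * w * exp (\<eta> w)"
      using sol [OF _ that(1) refl refl] red [OF that(2,4) s(1) refl refl] that by auto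
    also have "- 2 * s * w * exp (\<eta> w) = 2 * w * exp (\<eta> w - \<i> * of_real (pi * \<theta>))"
      unfolding s(2) diff_conv_add_uminus exp_add by simp
    finally show ?thesis .
  qed
  \<comment> \<open>With \<open>max R 0\<close> as radius every \<open>W n\<close> is nonzero, as
    \<open>sol_iff\<close> requires.\<close>
  have hol': "\<eta> holomorphic_on {w. max R 0 < norm w}"
    using hol by (rule holomorphic_on_subset) auto
  obtain W :: "nat \<Rightarrow> complex" and n0 :: nat and B :: real where "n0 \<ge> 1" and inj: "inj_on W {n0..}"
    and W: "\<And>n. n \<ge> n0 \<Longrightarrow> norm (W n) > max R 0 \<and> Re (W n) > 0 \<and> Im (W n) > 0 \<and>
        exp (W n) = 2 * W n * exp (\<eta> (W n) - \<i> * of_real (pi * \<theta>))"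
    and cover: "\<And>w. norm w \<ge> B \<Longrightarrow> Re w \<ge> 0 \<Longrightarrow> Im w \<ge> 0 \<Longrightarrow>
        exp w = 2 * w * exp (\<eta> w - \<i> * of_real (pi * \<theta>)) \<Longrightarrow> w \<in> W ` {n0..}"
    and asymp: "(\<lambda>n. W n - (of_real (ln (4 * pi * real n)) + \<i> * of_real (pi * (2 * real n + 1 / 2 - \<theta>))
           - \<i> * of_real (ln (4 * pi * real n) / (2 * pi * real n)) + of_real ((1 / 2 - \<theta>) / (2 * real n))
           - \<i> * ((\<kappa> + \<mu>) / 4) / of_real (2 * pi * real n)))
         \<in> o(\<lambda>n. 1 / of_nat n)"
    by (rule transcendental_roots [OF hol' lim, of \<theta>]) (rule that)
  define B' where "B' = max B (\<bar>R\<bar> + 1)"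
  define k where "k = (\<lambda>n. W n / of_real (2 * h))"
  have Wk: "W n = of_real (2 * h) * k n" for n
    using \<open>h > 0\<close> by (simp add: k_def)
  have covered: "z \<in> k ` {n0..}" if z: "sol z" "Re z \<ge> 0" "Im z \<ge> 0" "B' \<le> norm (of_real (2 * h) * z)" for z
  proof -
    define w where "w = of_real (2 * h) * z"
    have "norm w > R" "norm w \<ge> B" "norm w > 0"
      using z(4) unfolding w_def [symmetric] B'_def by linarith+
    moreover have "Re w \<ge> 0" "Im w \<ge> 0"
      using z \<open>h > 0\<close> by (simp_all add: w_def)
    ultimately have "w \<in> W ` {n0..}"
      using sol_iff [OF w_def] z(1) by (intro cover) auto
    then show ?thesis
      using \<open>h > 0\<close> by (auto simp: w_def Wk)
  qed
  \<comment> \<open>The witness that not every point is a solution: a real solution this large would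
    be some \<open>k n\<close>, contradicting \<open>Im (W n) > 0\<close>.\<close>
  have "\<not> sol (of_real (B' / (2 * h)))"
  proof
    assume "sol (of_real (B' / (2 * h)))"
    moreover have "B' \<ge> \<bar>R\<bar> + 1"
      by (simp add: B'_def)
    then have "B' > 0"
      by linarith
    ultimately have "of_real (B' / (2 * h)) \<in> k ` {n0..}"
      using \<open>h > 0\<close> by (intro covered) (auto simp: norm_mult)
    then obtain n where "n \<ge> n0" "k n = of_real (B' / (2 * h))"
      by auto
    then have "Im (W n) = 0"
      unfolding Wk by simp
    then show False
      using W [OF \<open>n \<ge> n0\<close>] by simp
  qed
  then have finite: "finite {z \<in> cball 0 (B' / (2 * h)). sol z}"
    by (rule fin)
  have "enumerates_up_to_finite k n0 {z. sol z \<and> Re z \<ge> 0 \<and> Im z \<ge> 0}"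
    unfolding enumerates_up_to_finite_def
  proof (intro conjI)
    show "inj_on k {n0..}"
      using inj \<open>h > 0\<close> by (auto simp: inj_on_def k_def)
    show "k ` {n0..} \<subseteq> {z. sol z \<and> Re z \<ge> 0 \<and> Im z \<ge> 0}"
    proof clarify
      fix n assume "n0 \<le> n"
      from W [OF this] have "sol (k n)"
        using sol_iff [OF Wk, of n] by auto
      moreover have "Re (k n) > 0" "Im (k n) > 0"
        using W [OF \<open>n0 \<le> n\<close>] \<open>h > 0\<close> unfolding k_def by (simp_all add: Re_divide_of_real Im_divide_of_real del: of_real_mult)
      ultimately show "sol (k n) \<and> 0 \<le> Re (k n) \<and> 0 \<le> Im (k n)"
        by simp
    qed
    show "finite ({z. sol z \<and> Re z \<ge> 0 \<and> Im z \<ge> 0} - k ` {n0..})"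
    proof (rule finite_subset [OF _ finite])
      show "{z. sol z \<and> Re z \<ge> 0 \<and> Im z \<ge> 0} - k ` {n0..} \<subseteq> {z \<in> cball 0 (B' / (2 * h)). sol z}"
      proof
        fix z assume z: "z \<in> {z. sol z \<and> Re z \<ge> 0 \<and> Im z \<ge> 0} - k ` {n0..}"
        then have "\<not> B' \<le> norm (of_real (2 * h) * z)"
          using covered by blast
        then have "norm z \<le> B' / (2 * h)"
          using \<open>h > 0\<close> by (simp add: norm_mult field_simps)
        then show "z \<in> {z \<in> cball 0 (B' / (2 * h)). sol z}"
          using z by simp
      qed
    qed
  qed
  moreover have scale: "(\<lambda>n. W n / d - E n / d) \<in> o(\<lambda>n. 1 / of_nat n)"
    if "(\<lambda>n. W n - E n) \<in> o(\<lambda>n. 1 / of_nat n)" "d \<noteq> 0" for E :: "nat \<Rightarrow> complex" and d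
  proof -
    have "(\<lambda>n. inverse d * (W n - E n)) \<in> o(\<lambda>n. 1 / of_nat n)"
      using that by simp
    moreover have "inverse d * (W n - E n) = W n / d - E n / d" for n
      by (simp add: divide_inverse algebra_simps)
    ultimately show ?thesis
      by (simp only:)
  qed
  have "(\<lambda>n. k n - (of_real (ln (4 * pi * real n)) + \<i> * of_real (pi * (2 * real n + 1 / 2 - \<theta>))
           - \<i> * of_real (ln (4 * pi * real n) / (2 * pi * real n)) + of_real ((1 / 2 - \<theta>) / (2 * real n))
           - \<i> * ((\<kappa> + \<mu>) / 4) / of_real (2 * pi * real n)) / of_real (2 * h))
         \<in> o(\<lambda>n. 1 / of_nat n)"
    unfolding k_def by (rule scale [OF asymp]) (use \<open>h > 0\<close> in simp)
  ultimately show ?thesis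
    using \<open>n0 \<ge> 1\<close> by blast
qed

theorem theorem2:
  fixes h kt kl :: real and p q :: "complex \<Rightarrow> complex"
  assumes "h > 0" and "kt > kl" and "kl > 0"
    and "\<And>k. (p k)\<^sup>2 = of_real (kl\<^sup>2) - k\<^sup>2"
    and "\<And>k. (q k)\<^sup>2 = of_real (kt\<^sup>2) - k\<^sup>2"
  shows
    "(\<exists>n0 \<ge> 1. \<exists>k :: nat \<Rightarrow> complex.
        enumerates_up_to_finite k n0
          {z. rayleigh_lamb_sym h (p z) (q z) z \<and> Re z \<ge> 0 \<and> Im z \<ge> 0} \<and>
        (\<lambda>n. k n -
            (of_real (1 / (2 * h) * ln (4 * pi * real n) - 1 / (8 * h * real n))
             + \<i> / of_real (2 * h) *
               of_real (pi * (2 * real n - 1 / 2)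
                 - ln (4 * pi * real n) / (2 * pi * real n)
                 - h\<^sup>2 * (kl\<^sup>2 + kt\<^sup>2) / (2 * pi * real n))))
          \<in> o(\<lambda>n. 1 / of_nat n)) \<and>
     (\<exists>n0 \<ge> 1. \<exists>k :: nat \<Rightarrow> complex.
        enumerates_up_to_finite k n0
          {z. rayleigh_lamb_antisym h (p z) (q z) z \<and> Re z \<ge> 0 \<and> Im z \<ge> 0} \<and>
        (\<lambda>n. k n -
            (of_real (1 / (2 * h) * ln (4 * pi * real n) - 3 / (8 * h * real n))
             + \<i> / of_real (2 * h) *
               of_real (pi * (2 * real n - 3 / 2)
                 - ln (4 * pi * real n) / (2 * pi * real n)
                 - h\<^sup>2 * (kl\<^sup>2 + kt\<^sup>2) / (2 * pi * real n))))
          \<in> o(\<lambda>n. 1 / of_nat n))"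
proof
  note p = assms(4) and q = assms(5)
  let ?\<kappa> = "complex_of_real ((2 * h * kt)\<^sup>2)" and ?\<mu> = "complex_of_real ((2 * h * kl)\<^sup>2)"
  have neq: "?\<kappa> \<noteq> ?\<mu>"
  proof -
    have "(2 * h * kl)\<^sup>2 < (2 * h * kt)\<^sup>2"
      using assms by (intro power_strict_mono) auto
    then show ?thesis
      by (metis less_irrefl of_real_eq_iff)
  qed
  \<comment> \<open>Division by \<open>2 * h\<close> gives the stated form with
    \<open>\<theta>\<close> still general: \<open>\<theta> = 1\<close> produces the constants 1/8
    and 1/2, and \<open>\<theta> = 2\<close> produces 3/8 and 3/2.\<close>
  have expansion: "(of_real (ln (4 * pi * real n)) + \<i> * of_real (pi * (2 * real n + 1 / 2 - \<theta>))
           - \<i> * of_real (ln (4 * pi * real n) / (2 * pi * real n)) + of_real ((1 / 2 - \<theta>) / (2 * real n))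
           - \<i> * ((?\<kappa> + ?\<mu>) / 4) / of_real (2 * pi * real n)) / of_real (2 * h)
     = of_real (1 / (2 * h) * ln (4 * pi * real n) - (2 * \<theta> - 1) / (8 * h * real n))
             + \<i> / of_real (2 * h) *
               of_real (pi * (2 * real n - (\<theta> - 1 / 2))
                 - ln (4 * pi * real n) / (2 * pi * real n)
                 - h\<^sup>2 * (kl\<^sup>2 + kt\<^sup>2) / (2 * pi * real n))" for n :: nat and \<theta> :: real
  proof -
    have "(?\<kappa> + ?\<mu>) / 4 = of_real (h\<^sup>2 * (kl\<^sup>2 + kt\<^sup>2))"
      by (simp add: power_mult_distrib algebra_simps)
    moreover have "(1 / 2 - \<theta>) / (2 * real n) / (2 * h) = - ((2 * \<theta> - 1) / (8 * h * real n))"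
      using \<open>h > 0\<close> by (cases "n = 0") (simp_all add: field_simps)
    ultimately show ?thesis
      by (simp only: of_real_diff of_real_add of_real_mult of_real_divide)
         (simp add: add_divide_distrib diff_divide_distrib algebra_simps)
  qed
  show "\<exists>n0 \<ge> 1. \<exists>k :: nat \<Rightarrow> complex.
        enumerates_up_to_finite k n0
          {z. rayleigh_lamb_sym h (p z) (q z) z \<and> Re z \<ge> 0 \<and> Im z \<ge> 0} \<and>
        (\<lambda>n. k n -
            (of_real (1 / (2 * h) * ln (4 * pi * real n) - 1 / (8 * h * real n))
             + \<i> / of_real (2 * h) *
               of_real (pi * (2 * real n - 1 / 2)
                 - ln (4 * pi * real n) / (2 * pi * real n)
                 - h\<^sup>2 * (kl\<^sup>2 + kt\<^sup>2) / (2 * pi * real n))))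
          \<in> o(\<lambda>n. 1 / of_nat n)"
  proof -
    have "finite {k \<in> cball 0 \<rho>. rayleigh_lamb_sym h (p k) (q k) k}"
      if "\<not> rayleigh_lamb_sym h (p k0) (q k0) k0" for \<rho> k0
      using finite_zeros_in_cball [OF p q, of "of_real (kt\<^sup>2)" k0 h \<rho>] that
      by (simp add: rayleigh_lamb_sym_def q)
    note fin = this
    have s: "1\<^sup>2 = (1 :: complex)" "1 = - exp (- (\<i> * of_real (pi * 1)))"
      by (simp_all add: exp_minus)
    have sol: "rayleigh_lamb_sym h (p k) (q k) k \<longleftrightarrow>
        ((?\<kappa> - 2 * w\<^sup>2)\<^sup>2 - 4 * w ^ 4 * a * b) * sinh (w * (a + b) / 2)
        + 1 * ((?\<kappa> - 2 * w\<^sup>2)\<^sup>2 + 4 * w ^ 4 * a * b) * sinh (w * (a - b) / 2) = 0"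
      if "k \<noteq> 0" "w = of_real (2 * h) * k" "a = csqrt (1 - ?\<kappa> / w\<^sup>2)" "b = csqrt (1 - ?\<mu> / w\<^sup>2)" for k w a b
      unfolding that(2-4) by (rule rayleigh_lamb_iff_sinh(1) [OF \<open>h > 0\<close> that(1) p q])
    have arith: "2 * 1 - 1 = (1 :: real)" "1 - 1 / 2 = (1 / 2 :: real)"
      by simp_all
    show ?thesis
      using enumeration_of_roots [OF \<open>h > 0\<close> neq s sol fin] unfolding expansion arith .
  qed
  show "\<exists>n0 \<ge> 1. \<exists>k :: nat \<Rightarrow> complex.
        enumerates_up_to_finite k n0
          {z. rayleigh_lamb_antisym h (p z) (q z) z \<and> Re z \<ge> 0 \<and> Im z \<ge> 0} \<and>
        (\<lambda>n. k n -
            (of_real (1 / (2 * h) * ln (4 * pi * real n) - 3 / (8 * h * real n))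
             + \<i> / of_real (2 * h) *
               of_real (pi * (2 * real n - 3 / 2)
                 - ln (4 * pi * real n) / (2 * pi * real n)
                 - h\<^sup>2 * (kl\<^sup>2 + kt\<^sup>2) / (2 * pi * real n))))
          \<in> o(\<lambda>n. 1 / of_nat n)"
  proof -
    \<comment> \<open>\<open>p\<close> and \<open>q\<close> are exchanged, since here the left-hand
      side is odd in \<open>p\<close>; \<open>K\<close> remains \<open>kt\<^sup>2\<close> because it
      comes from \<open>(q k)\<^sup>2 - k\<^sup>2\<close>.\<close>
    have "finite {k \<in> cball 0 \<rho>. rayleigh_lamb_antisym h (p k) (q k) k}"
      if "\<not> rayleigh_lamb_antisym h (p k0) (q k0) k0" for \<rho> k0
      using finite_zeros_in_cball [OF q p, of "of_real (kt\<^sup>2)" k0 h \<rho>] that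
      by (simp add: rayleigh_lamb_antisym_def q mult_ac)
    note fin = this
    have s: "(- 1)\<^sup>2 = (1 :: complex)" "(- 1) = - exp (- (\<i> * of_real (pi * 2)))"
      by (simp_all add: exp_minus)
    have sol: "rayleigh_lamb_antisym h (p k) (q k) k \<longleftrightarrow>
        ((?\<kappa> - 2 * w\<^sup>2)\<^sup>2 - 4 * w ^ 4 * a * b) * sinh (w * (a + b) / 2)
        + (- 1) * ((?\<kappa> - 2 * w\<^sup>2)\<^sup>2 + 4 * w ^ 4 * a * b) * sinh (w * (a - b) / 2) = 0"
      if "k \<noteq> 0" "w = of_real (2 * h) * k" "a = csqrt (1 - ?\<kappa> / w\<^sup>2)" "b = csqrt (1 - ?\<mu> / w\<^sup>2)" for k w a b
      unfolding that(2-4) by (rule rayleigh_lamb_iff_sinh(2) [OF \<open>h > 0\<close> that(1) p q])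
    have arith: "2 * 2 - 1 = (3 :: real)" "2 - 1 / 2 = (3 / 2 :: real)"
      by simp_all
    show ?thesis
      using enumeration_of_roots [OF \<open>h > 0\<close> neq s sol fin] unfolding expansion arith .
  qed
qed

end
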